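(* Let $a,b>-1$ and let $K_N^{(J)}$ be the correlation kernel of the Jacobi unitary ensemble with weight $w(x)=x^a(1-x)^b$ on $(0,1)$. Then for fixed $X,Y>0$, as $N\to\infty$, $$\frac{1}{4N^2}K_N^{(J)}\Big(\frac{X}{4N^2},\frac{Y}{4N^2}\Big)=K^{\rm hard}(X,Y)+\frac{a+b}{4N}J_a(\sqrt X)J_a(\sqrt Y)+O\Big(\frac1{N^2}\Big)$$ $$=K^{\rm hard}(X,Y)+\frac{a+b}{N}\Big(X\frac{\partial}{\partial X}+Y\frac{\partial}{\partial Y}+1\Big)K^{\rm hard}(X,Y)+O\Big(\frac1{N^2}\Big),$$ and thus, with $\tilde N=N+(a+b)/2$, $$\frac{1}{4\tilde N^2}K_N^{(J)}\Big(\frac{X}{4\tilde N^2},\frac{Y}{4\tilde N^2}\Big)=K^{\rm hard}(X,Y)+O\Big(\frac1{N^2}\Big).$$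
   Context: For a weight $w$, let $\{p_n\}$ be the monic orthogonal polynomials, $\int w\,p_mp_n\,dx=h_n\delta_{m,n}$. The correlation kernel of the ensemble with eigenvalue density proportional to $\prod_{l=1}^N w(x_l)\prod_{j<k}(x_k-x_j)^2$ is $$K_N(x,y)=\big(w(x)w(y)\big)^{1/2}\sum_{n=0}^{N-1}\frac{1}{h_n}p_n(x)p_n(y);$$ $K_N^{(J)}$ denotes this kernel for $w(x)=x^a(1-x)^b$, $0<x<1$. The hard edge (Bessel) kernel is $$K^{\rm hard}(x,y)=K^{\rm hard}(x,y;a)=\frac14\int_0^1J_a(\sqrt{xt})\,J_a(\sqrt{yt})\,dt,$$ with $J_a$ the Bessel function of the first kind. *)

theory Defs
  imports
    "HOL-Analysis.Analysis"
    "HOL-Library.Landau_Symbols"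
    "HOL-Computational_Algebra.Polynomial"
begin

text \<open>
  A weight is a function on the whole real line that vanishes outside its interval of support.
  The integrability clause is needed because the Bochner integral of a non-integrable function is 0
  by convention.
\<close>
definition monic_orthogonal :: "(real \<Rightarrow> real) \<Rightarrow> (nat \<Rightarrow> real poly) \<Rightarrow> bool" where
  "monic_orthogonal w p \<longleftrightarrow>
     (\<forall>n. degree (p n) = n \<and> lead_coeff (p n) = 1) \<and>
     (\<forall>m n. integrable lborel (\<lambda>x. w x * poly (p m) x * poly (p n) x)) \<and>
     (\<forall>m n. m \<noteq> n \<longrightarrow> (\<integral>x. w x * poly (p m) x * poly (p n) x \<partial>lborel) = 0)"

definition orth_poly :: "(real \<Rightarrow> real) \<Rightarrow> nat \<Rightarrow> real poly" where
  "orth_poly w = (THE p. monic_orthogonal w p)"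

definition orth_norm :: "(real \<Rightarrow> real) \<Rightarrow> nat \<Rightarrow> real" where
  "orth_norm w n = (\<integral>x. w x * poly (orth_poly w n) x * poly (orth_poly w n) x \<partial>lborel)"

definition corr_kernel :: "(real \<Rightarrow> real) \<Rightarrow> nat \<Rightarrow> real \<Rightarrow> real \<Rightarrow> real" where
  "corr_kernel w N x y =
     sqrt (w x * w y) *
     (\<Sum>n<N. 1 / orth_norm w n * poly (orth_poly w n) x * poly (orth_poly w n) y)"

definition jacobi_weight :: "real \<Rightarrow> real \<Rightarrow> real \<Rightarrow> real" where
  "jacobi_weight a b x = (if 0 < x \<and> x < 1 then x powr a * (1 - x) powr b else 0)"

definition jacobi_kernel :: "real \<Rightarrow> real \<Rightarrow> nat \<Rightarrow> real \<Rightarrow> real \<Rightarrow> real" where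
  "jacobi_kernel a b = corr_kernel (jacobi_weight a b)"

text \<open>
  Defining series of the Bessel function of the first kind, with real order \<open>a > -1\<close> and
  argument \<open>x > 0\<close>; the real power is not meaningful for other arguments.
\<close>
definition bessel_J :: "real \<Rightarrow> real \<Rightarrow> real" where
  "bessel_J a x =
     (\<Sum>m. (-1) ^ m / (fact m * Gamma (real m + a + 1)) * (x / 2) powr (2 * real m + a))"

definition hard_kernel :: "real \<Rightarrow> real \<Rightarrow> real \<Rightarrow> real" where
  "hard_kernel a x y =
     1 / 4 * (LBINT t:{0<..<1}. bessel_J a (sqrt (x * t)) * bessel_J a (sqrt (y * t)))"

end

theory Submission
  imports Defs "HOL-Real_Asymp.Real_Asymp"
begin

text \<open>
  Write \<open>c = a + b + 1\<close> and let \<open>phi n\<close> be the Jacobi polynomial normalised by \<open>phi n 0 = 1\<close>, whose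
  coefficients are even polynomials in \<open>n + c / 2\<close>. In the Christoffel--Darboux formula for the
  kernel with \<open>N\<close> terms only \<open>phi N\<close> and \<open>phi (N - 1)\<close> occur; these are the values of one even
  function of \<open>\<nu>\<close> at \<open>\<nu> = \<sigma> \<plusminus> 1 / 2\<close> with \<open>\<sigma> = N + (a + b) / 2\<close>. Passing to their mean and
  their divided difference makes every coefficient even in \<open>\<sigma>\<close>, so after scaling by \<open>\<sigma>\<^sup>2\<close> the
  kernel has no \<open>1 / \<sigma>\<close> correction. The limit is identified through the Lommel integral, that is the
  Christoffel--Darboux formula of the Bessel kernel. The expansions in \<open>N\<close> follow from the one in
  \<open>\<sigma>\<close> by differentiating the Bessel kernel along rescalings of its arguments.
\<close>

section \<open>Jacobi polynomials and the Christoffel--Darboux formula\<close>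

text \<open>The Christoffel-Darboux formula gives the kernel only multiplied by
  \<open>u - v\<close>, and an error of second order has to survive the division, on the diagonal as
  well. Hence every error carries a Lipschitz constant besides its bound, and continuity in
  \<open>u\<close> fills in the diagonal. Uniformity in \<open>u\<close> and \<open>v\<close> has a
  second purpose: with \<open>N\<close> in place of \<sigma> the arguments become
  \<open>l * u\<close>, \<open>l * v\<close> for \<open>l = (\<sigma> / N)^2\<close>, so the
  estimate is applied at moving points. The Gamma quotient in front of the sum must lack a
  \<open>1 / \<sigma>\<close> correction too. Its logarithmic increments are logarithms of ratios
  whose terms are symmetric about a common midpoint; \<open>ln ((1 + x) / (1 - x))\<close> is odd,
  so only cubic errors remain once the linear parts cancel, and these sum to order
  \<open>1 / n^2\<close>. Orthogonality comes from the same coefficient identities as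
  Christoffel-Darboux: the recurrence, together with the vanishing integral of \<open>phi n\<close>
  for \<open>n > 0\<close>, determines all inner products.\<close>

lemma Gamma_plus1_pos: "x > 0 \<Longrightarrow> Gamma (x + 1) = x * Gamma (x :: real)"
  by (rule Gamma_plus1) (auto dest: nonpos_Ints_nonpos)

locale jacobi =
  fixes a b :: real
  assumes a: "a > -1" and b: "b > -1"
begin

definition c :: real where "c = a + b + 1"

lemma c_gt: "c > -1"
  using a b by (simp add: c_def)

section \<open>Hypergeometric coefficients and their shift identities\<close>

definition bcoeff :: "nat \<Rightarrow> real" where
  "bcoeff k = (-1) ^ k / (pochhammer (a + 1) k * fact k)"

text \<open>
  The factors of \<open>A n k\<close> are \<open>(n + c / 2)\<^sup>2 - (j + c / 2)\<^sup>2\<close>; those of \<open>E n k\<close> are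
  \<open>(n + (c + 1) / 2)\<^sup>2 - (j + (c + 1) / 2)\<^sup>2\<close>, centred half a step further.
\<close>
definition A :: "nat \<Rightarrow> nat \<Rightarrow> real" where
  "A n k = (\<Prod>j<k. (real n - real j) * (real n + c + real j))"

definition E :: "nat \<Rightarrow> nat \<Rightarrow> real" where
  "E n k = (\<Prod>j<k. (real n - real j) * (real n + 1 + c + real j))"

lemma poch_pos: "pochhammer (a + 1) k > 0"
  using a by (intro pochhammer_pos) auto

lemma bcoeff_0 [simp]: "bcoeff 0 = 1"
  by (simp add: bcoeff_def)

lemma bcoeff_Suc: "bcoeff (Suc k) * (real k + 1) * (a + 1 + real k) = - bcoeff k"
  using poch_pos[of k] a by (auto simp: bcoeff_def pochhammer_Suc divide_simps)

lemma A_0 [simp]: "A n 0 = 1" and E_0 [simp]: "E n 0 = 1"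
  by (simp_all add: A_def E_def)

lemma A_Suc: "A n (Suc k) = A n k * ((real n - real k) * (real n + c + real k))"
  by (simp add: A_def)

lemma E_Suc: "E n (Suc k) = E n k * ((real n - real k) * (real n + 1 + c + real k))"
  by (simp add: E_def)

lemma A_eq_0: "k > n \<Longrightarrow> A n k = 0"
  by (auto simp: A_def)

lemma E_eq_0: "k > n \<Longrightarrow> E n k = 0"
  by (auto simp: E_def)

lemma A_nz: "k \<le> n \<Longrightarrow> A n k \<noteq> 0"
  using c_gt by (auto simp: A_def)

lemma A_Suc_Suc: "A (Suc n) (Suc k) = (real n + 1) * (real n + 1 + c + real k) * E n k"
proof (induction k)
  case (Suc k)
  then show ?case
    by (subst A_Suc, subst Suc.IH) (simp add: E_Suc algebra_simps)
qed (simp add: A_Suc add_ac)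

lemma A_Suc_right: "A n (Suc k) = (real n - real k) * (real n + c) * E n k"
proof (induction k)
  case (Suc k)
  then show ?case
    by (subst A_Suc, subst Suc.IH) (simp add: E_Suc algebra_simps)
qed (simp add: A_Suc)

text \<open>Both products contain \<open>E n k\<close>, and the remaining factors differ by a
  multiple of \<open>2 * real n + 1 + c\<close>, twice the centre \<open>n + (c + 1) / 2\<close>.
  Dividing by this odd factor leaves a difference quotient that is even about the centre.\<close>

lemma A_diff: "A (Suc n) (Suc k) - A n (Suc k) = (real k + 1) * (2 * real n + 1 + c) * E n k"
  unfolding A_Suc_Suc[of n k] A_Suc_right[of n k] by algebra

text \<open>The centre enters only through its square, so the mean is as even as \<open>E\<close>; a
  single \<open>A\<close> also has a term linear in the centre, which averaging removes.\<close>

lemma A_mean: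
  "(A (Suc n) (Suc k) + A n (Suc k)) / 2 =
     E n k * ((real n + (c + 1) / 2) ^ 2 - ((c - 1) ^ 2 / 4 + (real k + 1) * (c - 1) / 2))"
  unfolding A_Suc_Suc[of n k] A_Suc_right[of n k] by (simp add: field_simps power2_eq_square)

lemma E_A: "(real n + c) * E n k = A n k * (real n + c + real k)"
proof (induction k)
  case (Suc k)
  have "(real n + c) * E n (Suc k) = ((real n + c) * E n k) * ((real n - real k) * (real n + 1 + c + real k))"
    by (simp add: E_Suc)
  then show ?case
    by (subst (asm) Suc.IH) (simp add: A_Suc algebra_simps)
qed simp

lemma E_A': "(real n + 1) * E n k = A (Suc n) k * (real n + 1 - real k)"
proof (induction k)
  case (Suc k)
  have "(real n + 1) * E n (Suc k) = ((real n + 1) * E n k) * ((real n - real k) * (real n + 1 + c + real k))"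
    by (simp add: E_Suc)
  then show ?case
    by (subst (asm) Suc.IH) (simp add: A_Suc algebra_simps)
qed simp

text \<open>
  This is \<open>\<Gamma>(n + c) \<Gamma>(n + a + 1) / (\<Gamma>(n) \<Gamma>(n + b))\<close>; the case distinction keeps clear of the
  junk values of \<open>Gamma\<close> at its poles.
\<close>
definition G :: "nat \<Rightarrow> real" where
  "G n = (case n of 0 \<Rightarrow> 0 | Suc m \<Rightarrow>
     Gamma (real m + 1 + c) * Gamma (real m + a + 2) / (fact m * Gamma (real m + b + 1)))"

lemma G_0 [simp]: "G 0 = 0"
  by (simp add: G_def)

lemma G_1: "G (Suc 0) = Gamma (1 + c) * Gamma (a + 2) / Gamma (b + 1)"
  by (simp add: G_def)

lemma G_pos: "G (Suc n) > 0"
  using a b c_gt by (simp add: G_def Gamma_real_pos)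

lemma G_Suc:
  "G (Suc (Suc n)) * ((real n + 1) * (real n + 1 + b)) =
     G (Suc n) * ((real n + 1 + c) * (real n + a + 2))"
proof -
  have 1: "Gamma (real (Suc n) + 1 + c) = (real n + 1 + c) * Gamma (real n + 1 + c)"
    using Gamma_plus1_pos[of "real n + 1 + c"] c_gt by (simp add: add_ac)
  have 2: "Gamma (real (Suc n) + a + 2) = (real n + a + 2) * Gamma (real n + a + 2)"
    using Gamma_plus1_pos[of "real n + a + 2"] a by (simp add: add_ac)
  have 3: "Gamma (real (Suc n) + b + 1) = (real n + 1 + b) * Gamma (real n + b + 1)"
    using Gamma_plus1_pos[of "real n + b + 1"] b by (simp add: add_ac)
  have 4: "Gamma (real n + b + 1) > 0" "real n + 1 + b > 0"
    using b by (auto intro: Gamma_real_pos)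
  define g1 where "g1 = Gamma (real n + 1 + c)"
  define g2 where "g2 = Gamma (real n + a + 2)"
  define g3 where "g3 = Gamma (real n + b + 1)"
  define d where "d = real n + 1 + b"
  have nz: "g3 > 0" "d > 0"
    using 4 by (simp_all only: g3_def d_def)
  have "G (Suc (Suc n)) = (real n + 1 + c) * g1 * ((real n + a + 2) * g2) / ((real n + 1) * fact n * (d * g3))"
    unfolding G_def nat.case 1 2 3 g1_def g2_def g3_def d_def by (simp add: add_ac)
  moreover have "G (Suc n) = g1 * g2 / (fact n * g3)"
    by (simp add: G_def g1_def g2_def g3_def)
  ultimately have "G (Suc (Suc n)) * ((real n + 1) * fact n * (d * g3)) =
      (real n + 1 + c) * g1 * ((real n + a + 2) * g2)" "G (Suc n) * (fact n * g3) = g1 * g2"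
    using nz by (simp_all add: divide_simps)
  then have "(fact n * g3) * (G (Suc (Suc n)) * ((real n + 1) * d)) =
      (fact n * g3) * (G (Suc n) * ((real n + 1 + c) * (real n + a + 2)))"
    by algebra
  then show ?thesis
    unfolding d_def using nz by simp
qed

text \<open>Forced by the constant coefficient, \<open>k = 0\<close>, of \<open>r_A_Suc\<close>. By
  \<open>L_norm\<close> it is \<open>Gamma (a + 1) ^ 2\<close> divided by the squared norm of
  \<open>phi n\<close>.\<close>

definition r :: "nat \<Rightarrow> real" where
  "r n = (G (Suc n) - G n) / (a + 1)"

text \<open>A product form, in which positivity is visible; the difference in the definition hides
  it.\<close>

lemma r_Suc: "r (Suc n) * ((real n + 1) * (real n + 1 + b)) = G (Suc n) * (2 * real n + 2 + c)"
proof -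
  have "r (Suc n) * ((real n + 1) * (real n + 1 + b)) =
     (G (Suc (Suc n)) * ((real n + 1) * (real n + 1 + b)) - G (Suc n) * ((real n + 1) * (real n + 1 + b))) / (a + 1)"
    by (simp add: r_def field_simps)
  also have "\<dots> = G (Suc n) * (2 * real n + 2 + c)"
    unfolding G_Suc using a by (simp add: field_simps c_def)
  finally show ?thesis .
qed

lemma r_0: "r 0 = G (Suc 0) / (a + 1)"
  by (simp add: r_def)

lemma r_pos: "r n > 0"
proof (cases n)
  case 0
  then show ?thesis using G_pos[of 0] a by (simp add: r_0)
next
  case (Suc m)
  have "0 < G (Suc m) * (2 * real m + 2 + c)"
    using G_pos c_gt by simp
  then have "0 < r n * ((real m + 1) * (real m + 1 + b))"
    using r_Suc Suc by simp
  moreover have "(real m + 1) * (real m + 1 + b) > 0"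
    using b by simp
  ultimately show ?thesis
    using zero_less_mult_pos2 by blast
qed

lemma r_A_0: "r 0 * A 0 k * (a + 1 + real k) = G (Suc 0) * E 0 k"
proof (cases k)
  case 0
  then show ?thesis using a by (simp add: r_0)
qed (simp add: A_eq_0 E_eq_0)

text \<open>The recurrence read off at one coefficient: by \<open>bcoeff_Suc\<close>, the index
  shift caused by multiplication with \<open>x\<close> produces the factor
  \<open>a + 1 + real k\<close>. Both \<open>E\<close> terms are reduced to
  \<open>A (Suc n) k\<close>.\<close>

lemma r_A_Suc:
  "r (Suc n) * A (Suc n) k * (a + 1 + real k) = G (Suc (Suc n)) * E (Suc n) k - G (Suc n) * E n k"
proof -
  let ?n = "real n + 1"
  let ?d = "?n * (?n + b) * (?n + c)"
  have nz: "?n * (?n + b) \<noteq> 0" "?n + c \<noteq> 0"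
    using b c_gt by auto
  have E1: "(?n + c) * E (Suc n) k = A (Suc n) k * (?n + c + real k)"
    using E_A[of "Suc n" k] by (simp add: add_ac)
  have E2: "?n * E n k = A (Suc n) k * (?n - real k)"
    using E_A'[of n k] .
  have GS: "G (Suc (Suc n)) * (?n * (?n + b)) = G (Suc n) * ((?n + c) * (?n + a + 1))"
    using G_Suc[of n] by (simp add: add_ac)
  have rS: "r (Suc n) * (?n * (?n + b)) = G (Suc n) * (2 * ?n + c)"
    using r_Suc[of n] by (simp add: add_ac)
  have "(G (Suc (Suc n)) * E (Suc n) k - G (Suc n) * E n k) * (?n * (?n + b))
      = G (Suc n) * ((?n + a + 1) * ((?n + c) * E (Suc n) k) - (?n + b) * (?n * E n k))"
    using GS by algebra
  also have "\<dots> = G (Suc n) * A (Suc n) k * ((?n + a + 1) * (?n + c + real k) - (?n + b) * (?n - real k))"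
    unfolding E1 E2 by algebra
  \<comment> \<open>The squares of \<open>?n\<close> cancel, and \<open>c = a + b + 1\<close> makes
    the rest factor.\<close>
  also have "(?n + a + 1) * (?n + c + real k) - (?n + b) * (?n - real k) = (2 * ?n + c) * (a + 1 + real k)"
    unfolding c_def by algebra
  also have "G (Suc n) * A (Suc n) k * ((2 * ?n + c) * (a + 1 + real k))
     = (r (Suc n) * A (Suc n) k * (a + 1 + real k)) * (?n * (?n + b))"
    using rS by algebra
  finally show ?thesis
    using nz by simp
qed

text \<open>The hypergeometric polynomial \<open>F(-n, n + c; a + 1; x)\<close>, a multiple of the
  Jacobi polynomial in \<open>1 - 2 * x\<close>.\<close>

definition phi :: "nat \<Rightarrow> real poly" where
  "phi n = Abs_poly (\<lambda>k. bcoeff k * A n k)"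

text \<open>The divided difference of \<open>phi\<close> in \<open>n\<close>; see \<open>phi_Suc\<close>.\<close>
definition dphi :: "nat \<Rightarrow> real poly" where
  "dphi n = Abs_poly (\<lambda>k. case k of 0 \<Rightarrow> 0 | Suc j \<Rightarrow> bcoeff k * real k * E n j)"

lemma coeff_phi: "coeff (phi n) k = bcoeff k * A n k"
  unfolding phi_def by (subst coeff_Abs_poly[of n]) (auto simp: A_eq_0)

lemma coeff_dphi_0 [simp]: "coeff (dphi n) 0 = 0"
  unfolding dphi_def by (subst coeff_Abs_poly[of "Suc n"]) (auto simp: E_eq_0 split: nat.splits)

lemma coeff_dphi_Suc: "coeff (dphi n) (Suc k) = bcoeff (Suc k) * (real k + 1) * E n k"
  unfolding dphi_def
  by (subst coeff_Abs_poly[of "Suc n"]) (auto simp: E_eq_0 add_ac split: nat.splits)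

lemma phi_0 [simp]: "phi 0 = 1"
  by (rule poly_eqI) (auto simp: coeff_phi coeff_1 A_eq_0)

lemma phi_Suc: "phi (Suc n) = phi n + smult (2 * real n + 1 + c) (dphi n)"
proof (rule poly_eqI)
  fix k
  show "coeff (phi (Suc n)) k = coeff (phi n + smult (2 * real n + 1 + c) (dphi n)) k"
  proof (cases k)
    case (Suc j)
    show ?thesis
      unfolding Suc coeff_phi coeff_dphi_Suc coeff_add coeff_smult
      using A_diff[of n j] by algebra
  qed (simp add: coeff_phi)
qed

lemma bcoeff_nz: "bcoeff k \<noteq> 0"
  using poch_pos[of k] by (simp add: bcoeff_def)

lemma degree_phi [simp]: "degree (phi n) = n"
proof (rule antisym)
  show "degree (phi n) \<le> n"
    by (rule degree_le) (simp add: coeff_phi A_eq_0)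
  show "n \<le> degree (phi n)"
    by (rule le_degree) (simp add: coeff_phi A_nz bcoeff_nz)
qed

lemma lead_coeff_phi_nz [simp]: "coeff (phi n) n \<noteq> 0"
  by (simp add: coeff_phi A_nz bcoeff_nz)

lemma recurrence_0: "smult (r 0) (pCons 0 (phi 0)) = - smult (G (Suc 0)) (dphi 0)"
proof (rule poly_eqI)
  fix k
  show "coeff (smult (r 0) (pCons 0 (phi 0))) k = coeff (- smult (G (Suc 0)) (dphi 0)) k"
  proof (cases k)
    case (Suc j)
    have "r 0 * (bcoeff j * A 0 j) = - (bcoeff (Suc j) * (real j + 1) * (r 0 * A 0 j * (a + 1 + real j)))"
      using bcoeff_Suc[of j] by algebra
    with Suc show ?thesis unfolding r_A_0
      by (simp add: coeff_phi coeff_dphi_Suc del: phi_0)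
  qed (simp del: phi_0)
qed

lemma recurrence_Suc:
  "smult (r (Suc n)) (pCons 0 (phi (Suc n))) =
     smult (G (Suc n)) (dphi n) - smult (G (Suc (Suc n))) (dphi (Suc n))"
proof (rule poly_eqI)
  fix k
  show "coeff (smult (r (Suc n)) (pCons 0 (phi (Suc n)))) k =
     coeff (smult (G (Suc n)) (dphi n) - smult (G (Suc (Suc n))) (dphi (Suc n))) k"
  proof (cases k)
    case (Suc j)
    have "r (Suc n) * (bcoeff j * A (Suc n) j) =
       - (bcoeff (Suc j) * (real j + 1) * (r (Suc n) * A (Suc n) j * (a + 1 + real j)))"
      using bcoeff_Suc[of j] by algebra
    with Suc show ?thesis unfolding r_A_Suc
      by (simp add: coeff_phi coeff_dphi_Suc algebra_simps)
  qed simp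
qed

text \<open>Telescoping: the recurrence expresses \<open>r n * x * phi n\<close> as a difference of
  consecutive \<open>G * dphi\<close>. The Wronskian of \<open>dphi N\<close> with
  \<open>phi N\<close> equals that with \<open>phi (Suc N)\<close>, because the two differ by a
  multiple of \<open>dphi N\<close>.\<close>

theorem christoffel_darboux:
  "(x - y) * (\<Sum>n<Suc N. r n * poly (phi n) x * poly (phi n) y) =
     - G (Suc N) * (poly (dphi N) x * poly (phi N) y - poly (phi N) x * poly (dphi N) y)"
proof (induction N)
  case 0
  have "r 0 * x = - G (Suc 0) * poly (dphi 0) x" for x
    using arg_cong[OF recurrence_0, of "\<lambda>p. poly p x"] by (simp add: mult.commute)
  from this[of x] this[of y] show ?case
    by (simp add: algebra_simps)
next
  case (Suc N)
  have rec: "r (Suc N) * x * poly (phi (Suc N)) x =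
      G (Suc N) * poly (dphi N) x - G (Suc (Suc N)) * poly (dphi (Suc N)) x" for x
    using arg_cong[OF recurrence_Suc, of "\<lambda>p. poly p x" N] by (simp add: algebra_simps)
  have ph: "poly (phi (Suc N)) x = poly (phi N) x + (2 * real N + 1 + c) * poly (dphi N) x" for x
    by (simp add: phi_Suc)
  have "(x - y) * (\<Sum>n<Suc (Suc N). r n * poly (phi n) x * poly (phi n) y) =
     - G (Suc N) * (poly (dphi N) x * poly (phi N) y - poly (phi N) x * poly (dphi N) y)
     + (r (Suc N) * x * poly (phi (Suc N)) x) * poly (phi (Suc N)) y
     - poly (phi (Suc N)) x * (r (Suc N) * y * poly (phi (Suc N)) y)"
    unfolding sum.lessThan_Suc[of _ "Suc N"] distrib_left Suc.IH by algebra
  also have "\<dots> = - G (Suc (Suc N)) * (poly (dphi (Suc N)) x * poly (phi (Suc N)) y -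
         poly (phi (Suc N)) x * poly (dphi (Suc N)) y)"
    using rec[of x] rec[of y] ph[of x] ph[of y] by algebra
  finally show ?case .
qed

subsection \<open>Orthogonality\<close>

definition L :: "real poly \<Rightarrow> real" where
  "L p = (\<integral>x. jacobi_weight a b x * poly p x \<partial>lborel)"

lemma has_bochner_integral_moment:
  "has_bochner_integral lborel (\<lambda>x. jacobi_weight a b x * x ^ k) (Beta (a + 1 + real k) (b + 1))"
proof -
  let ?f = "\<lambda>x. x powr (a + 1 + real k - 1) * (1 - x) powr (b + 1 - 1)"
  have eq: "jacobi_weight a b x * x ^ k = indicator {0..1} x *\<^sub>R ?f x" for x
    by (auto simp: jacobi_weight_def indicator_def powr_add powr_realpow)
  have int: "set_integrable lborel {0..1} ?f"
    using a b by (intro integrable_Beta) auto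
  have "(LINT x : {0..1} | lborel. ?f x) = Beta (a + 1 + real k) (b + 1)"
    unfolding set_borel_integral_eq_integral(2)[OF int]
    using a b by (intro integral_unique has_integral_Beta_real) auto
  then show ?thesis
    using int unfolding eq set_integrable_def set_lebesgue_integral_def
    by (simp add: has_bochner_integral_iff)
qed

lemma has_bochner_integral_poly:
  assumes "degree p \<le> n"
  shows "has_bochner_integral lborel (\<lambda>x. jacobi_weight a b x * poly p x)
           (\<Sum>k\<le>n. coeff p k * Beta (a + 1 + real k) (b + 1))"
proof -
  have "has_bochner_integral lborel (\<lambda>x. \<Sum>k\<le>n. coeff p k * (jacobi_weight a b x * x ^ k))
           (\<Sum>k\<le>n. coeff p k * Beta (a + 1 + real k) (b + 1))"
    by (intro has_bochner_integral_sum has_bochner_integral_mult_right has_bochner_integral_moment)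
  also have "(\<lambda>x. \<Sum>k\<le>n. coeff p k * (jacobi_weight a b x * x ^ k)) = (\<lambda>x. jacobi_weight a b x * poly p x)"
    by (subst (2) poly_as_sum_of_monoms'[OF assms, symmetric])
      (simp add: poly_sum poly_monom sum_distrib_left mult_ac)
  finally show ?thesis .
qed

lemma integrable_poly: "integrable lborel (\<lambda>x. jacobi_weight a b x * poly p x)"
  using has_bochner_integral_poly[OF order.refl] by (rule integrable.intros)

lemma L_eq: "degree p \<le> n \<Longrightarrow> L p = (\<Sum>k\<le>n. coeff p k * Beta (a + 1 + real k) (b + 1))"
  unfolding L_def by (rule has_bochner_integral_integral_eq[OF has_bochner_integral_poly])

lemma L_add: "L (p + q) = L p + L q"
  unfolding L_def using integrable_poly[of p] integrable_poly[of q] by (simp add: algebra_simps)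

lemma L_diff: "L (p - q) = L p - L q"
  unfolding L_def using integrable_poly[of p] integrable_poly[of q] by (simp add: algebra_simps)

lemma L_smult: "L (smult t p) = t * L p"
  unfolding L_def by (simp add: mult.left_commute)

lemma L_0 [simp]: "L 0 = 0"
  by (simp add: L_def)

lemma Beta_moment:
  "Beta (a + 1 + real k) (b + 1) * pochhammer (c + 1) k = pochhammer (a + 1) k * Beta (a + 1) (b + 1)"
proof (induction k)
  case (Suc k)
  have ni: "a + 1 + real k \<notin> \<int>\<^sub>\<le>\<^sub>0"
    using a by (auto dest: nonpos_Ints_nonpos)
  have "(a + 1 + real k + (b + 1)) * Beta (a + 1 + real k + 1) (b + 1) = (a + 1 + real k) * Beta (a + 1 + real k) (b + 1)"
    by (rule Beta_plus1_left[OF ni])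
  then have "(c + 1 + real k) * Beta (a + 1 + real (Suc k)) (b + 1) = (a + 1 + real k) * Beta (a + 1 + real k) (b + 1)"
    by (simp add: c_def add_ac)
  with Suc.IH show ?case
    unfolding pochhammer_Suc by algebra
qed simp

text \<open>
  Partial sums of the hypergeometric series \<open>F(-n, n + c; c + 1; 1)\<close>; the upper parameters sum to
  the lower one minus 1, which is what makes them telescope.
\<close>
lemma sum_vandermonde:
  "(\<Sum>k\<le>K. (-1) ^ k * A n k / (fact k * pochhammer (c + 1) k)) =
     (-1) ^ K * (\<Prod>j<K. (real n - 1 - real j) * (real n + c + 1 + real j)) / (fact K * pochhammer (c + 1) K)"
proof (induction K)
  case (Suc K)
  define F where "F = (\<Prod>j<K. (real n - 1 - real j) * (real n + c + 1 + real j))"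
  define d where "d = fact K * pochhammer (c + 1) K"
  have d: "d > 0" unfolding d_def using c_gt by (intro mult_pos_pos pochhammer_pos) auto
  have A: "A n (Suc K) = real n * (real n + c) * F"
    unfolding A_def F_def prod.lessThan_Suc_shift by (simp add: algebra_simps)
  have dS: "fact (Suc K) * pochhammer (c + 1) (Suc K) = d * ((real K + 1) * (c + 1 + real K))"
    by (simp add: d_def pochhammer_Suc add_ac)
  have nz: "(real K + 1) * (c + 1 + real K) > 0"
    using c_gt by simp
  have eq: "(real n - 1 - real K) * (real n + c + 1 + real K) + (real K + 1) * (c + 1 + real K) = real n * (real n + c)"
    by algebra
  have add: "s * F / d + - s * ((e + f) * F) / (d * f) = - s * (F * e) / (d * f)" if "f > 0" for s e f
    using that d by (simp add: field_simps)
  show ?case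
    unfolding sum.atMost_Suc Suc.IH F_def[symmetric] d_def[symmetric] A dS eq[symmetric]
      prod.lessThan_Suc
    using add[OF nz] by simp
qed simp

lemma L_phi: "n > 0 \<Longrightarrow> L (phi n) = 0"
proof -
  assume n: "n > 0"
  have "L (phi n) = (\<Sum>k\<le>n. bcoeff k * A n k * Beta (a + 1 + real k) (b + 1))"
    by (subst L_eq[of _ n]) (simp_all add: coeff_phi)
  also have "\<dots> = (\<Sum>k\<le>n. Beta (a + 1) (b + 1) * ((-1) ^ k * A n k / (fact k * pochhammer (c + 1) k)))"
  proof (rule sum.cong[OF refl])
    fix k
    have "pochhammer (c + 1) k > 0"
      using c_gt by (intro pochhammer_pos) auto
    then show "bcoeff k * A n k * Beta (a + 1 + real k) (b + 1) =
        Beta (a + 1) (b + 1) * ((-1) ^ k * A n k / (fact k * pochhammer (c + 1) k))"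
      using Beta_moment[of k] poch_pos[of k] unfolding bcoeff_def
      by (simp add: divide_simps)
  qed
  also have "\<dots> = 0"
    unfolding sum_distrib_left[symmetric] sum_vandermonde using n
    by (force simp: prod_zero_iff intro!: bexI[of _ "n - 1"])
  finally show ?thesis .
qed

text \<open>Up to sign, the off-diagonal entries of the symmetric tridiagonal matrix in
  \<open>three_term\<close>. The value 0 at 0, inherited from \<open>G\<close>, silences the term
  \<open>phi (n - 1)\<close> at \<open>n = 0\<close>, where natural subtraction returns
  \<open>phi 0\<close>.\<close>

definition offdiag :: "nat \<Rightarrow> real" where
  "offdiag n = G n / (2 * real n - 1 + c)"

lemma offdiag_0 [simp]: "offdiag 0 = 0"
  by (simp add: offdiag_def)

lemma offdiag_pos: "offdiag (Suc n) > 0"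
  using G_pos[of n] c_gt by (simp add: offdiag_def)

lemma G_dphi: "smult (G (Suc n)) (dphi n) = smult (offdiag (Suc n)) (phi (Suc n) - phi n)"
  using c_gt by (simp add: phi_Suc offdiag_def add_ac)

lemma three_term:
  "smult (r n) (pCons 0 (phi n)) = smult (offdiag n) (phi n - phi (n - 1)) - smult (offdiag (Suc n)) (phi (Suc n) - phi n)"
proof (cases n)
  case 0
  then show ?thesis using recurrence_0 G_dphi[of 0] by simp
next
  case (Suc m)
  then show ?thesis using recurrence_Suc[of m] G_dphi[of m] G_dphi[of "Suc m"] by simp
qed

lemma L_three_term:
  "r n * L (pCons 0 (phi n) * q) =
     offdiag n * (L (phi n * q) - L (phi (n - 1) * q)) - offdiag (Suc n) * (L (phi (Suc n) * q) - L (phi n * q))"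
proof -
  have "r n * L (pCons 0 (phi n) * q) = L (smult (r n) (pCons 0 (phi n)) * q)"
    by (simp only: L_smult mult_smult_left)
  also have "smult (r n) (pCons 0 (phi n)) * q =
      smult (offdiag n) (phi n * q - phi (n - 1) * q) - smult (offdiag (Suc n)) (phi (Suc n) * q - phi n * q)"
    unfolding three_term by (simp add: algebra_simps smult_diff_right)
  finally show ?thesis
    by (simp only: L_smult L_diff)
qed

text \<open>Multiplication by \<open>x\<close> may be moved between the factors. On
  \<open>phi n\<close> it produces only indices above \<open>k\<close>, all orthogonal to
  \<open>phi k\<close>; on \<open>phi k\<close> it produces \<open>phi (Suc k)\<close>, whose
  product with \<open>phi n\<close> must then integrate to 0 as well.\<close>

lemma L_orthogonal_less: "m < n \<Longrightarrow> L (phi m * phi n) = 0"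
proof (induction m arbitrary: n rule: less_induct)
  case (less m)
  show ?case
  proof (cases m)
    case 0
    then show ?thesis using less.prems by (simp add: L_phi)
  next
    case (Suc k)
    have k: "L (phi k * phi j) = 0" if "j > k" for j
      using less.IH[of k j] that Suc by simp
    have offdiag: "offdiag k * L (phi (k - 1) * phi n) = 0"
    proof (cases k)
      case (Suc l)
      then show ?thesis using less.IH[of l n] less.prems \<open>m = Suc k\<close> by simp
    qed simp
    have "r n * L (pCons 0 (phi n) * phi k) = 0"
      unfolding L_three_term using k[of n] k[of "n - 1"] k[of "Suc n"] less.prems Suc
      by (simp add: mult.commute)
    then have "L (pCons 0 (phi k) * phi n) = 0"
      using r_pos[of n] by (simp add: mult.commute)
    then have "offdiag (Suc k) * L (phi (Suc k) * phi n) = 0"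
      using L_three_term[of k "phi n"] offdiag k[of n] less.prems Suc by (simp add: algebra_simps)
    then show ?thesis using offdiag_pos[of k] Suc by simp
  qed
qed

lemma L_orthogonal: "m \<noteq> n \<Longrightarrow> L (phi m * phi n) = 0"
  using L_orthogonal_less[of m n] L_orthogonal_less[of n m] by (cases "m < n") (auto simp: mult.commute)

text \<open>Evaluating \<open>L\<close> of \<open>x * phi n * phi (Suc n)\<close> by the recurrence
  for either factor gives the same coefficient \<open>offdiag (Suc n)\<close>, so the left-hand side
  is constant in \<open>n\<close>. Its value is read off at \<open>n = 0\<close> from the Beta
  integral.\<close>

lemma L_norm: "r n * L (phi n * phi n) = Gamma (a + 1) ^ 2"
proof (induction n)
  case 0
  have pos: "Gamma (b + 1) > 0" "Gamma (c + 1) > 0"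
    using b c_gt by (auto intro: Gamma_real_pos)
  have "L (phi 0 * phi 0) = Beta (a + 1) (b + 1)"
    using L_eq[of 1 0] by (simp add: one_pCons)
  moreover have "Gamma (a + 2) = (a + 1) * Gamma (a + 1)"
    using Gamma_plus1_pos[of "a + 1"] a by (simp add: add_ac)
  ultimately show ?case
    using pos a by (simp add: r_0 G_1 Beta_def c_def power2_eq_square add_ac)
next
  case (Suc n)
  have 1: "r (Suc n) * L (pCons 0 (phi (Suc n)) * phi n) = - offdiag (Suc n) * L (phi n * phi n)"
    unfolding L_three_term using L_orthogonal[of "Suc n" n] L_orthogonal[of "Suc (Suc n)" n] by simp
  have 2: "r n * L (pCons 0 (phi n) * phi (Suc n)) = - offdiag (Suc n) * L (phi (Suc n) * phi (Suc n))"
    unfolding L_three_term using L_orthogonal[of n "Suc n"] L_orthogonal[of "n - 1" "Suc n"] by simp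
  have "L (pCons 0 (phi n) * phi (Suc n)) = L (pCons 0 (phi (Suc n)) * phi n)"
    by (simp add: mult.commute)
  with 1 2 have "offdiag (Suc n) * (r (Suc n) * L (phi (Suc n) * phi (Suc n))) = offdiag (Suc n) * (r n * L (phi n * phi n))"
    by algebra
  then show ?case using Suc.IH offdiag_pos[of n] by simp
qed

section \<open>Uniqueness of the monic orthogonal family\<close>

lemma L_eq_0_of_lower:
  assumes q: "\<And>k. degree (q k) = k" "\<And>k. lead_coeff (q k) = 1"
    and h: "\<And>k. k < n \<Longrightarrow> L (q k * h) = 0"
    and p: "\<And>i. i \<ge> n \<Longrightarrow> coeff p i = 0"
  shows "L (p * h) = 0"
proof -
  \<comment> \<open>Degree below \<open>m\<close> is expressed by vanishing coefficients, so that
    \<open>m = 0\<close> means the zero polynomial.\<close>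
  have "(\<forall>i\<ge>m. coeff p i = 0) \<Longrightarrow> m \<le> n \<Longrightarrow> L (p * h) = 0" for m p
  proof (induction m arbitrary: p)
    case 0
    then have "p = 0" by (intro poly_eqI) auto
    then show ?case by simp
  next
    case (Suc m)
    let ?p = "p - smult (coeff p m) (q m)"
    have p': "coeff ?p i = 0" if "i \<ge> m" for i
      using that Suc.prems(1) q(2)[of m] by (cases "i = m") (auto simp: q coeff_eq_0)
    have "L (?p * h) = 0"
    proof (rule Suc.IH)
      show "\<forall>i\<ge>m. coeff ?p i = 0" using p' by blast
    qed (use Suc.prems(2) in simp)
    moreover have "?p * h = p * h - smult (coeff p m) (q m * h)"
      by (simp add: algebra_simps)
    ultimately show ?case
      using h[of m] Suc.prems by (simp add: L_diff L_smult)
  qed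
  from this[of n p] p show ?thesis by simp
qed

definition monic_phi :: "nat \<Rightarrow> real poly" where
  "monic_phi n = smult (1 / lead_coeff (phi n)) (phi n)"

lemma degree_monic_phi: "degree (monic_phi n) = n"
  and lead_coeff_monic_phi: "lead_coeff (monic_phi n) = 1"
  by (simp_all add: monic_phi_def)

lemma L_monic_phi:
  "L (monic_phi m * monic_phi n) = L (phi m * phi n) / (lead_coeff (phi m) * lead_coeff (phi n))"
  unfolding monic_phi_def by (simp add: L_smult)

lemma L_phi_pos: "L (phi n * phi n) > 0"
proof -
  have "0 < r n * L (phi n * phi n)"
    unfolding L_norm using a by (intro zero_less_power Gamma_real_pos) auto
  from zero_less_mult_pos[OF this r_pos] show ?thesis .
qed

lemma monic_orthogonal_iff:
  "monic_orthogonal (jacobi_weight a b) q \<longleftrightarrow>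
     (\<forall>n. degree (q n) = n \<and> lead_coeff (q n) = 1) \<and> (\<forall>m n. m \<noteq> n \<longrightarrow> L (q m * q n) = 0)"
  using integrable_poly[of "_ * _"] by (simp add: monic_orthogonal_def L_def mult.assoc)

lemma monic_orthogonal_phi: "monic_orthogonal (jacobi_weight a b) monic_phi"
  unfolding monic_orthogonal_iff
  using degree_monic_phi lead_coeff_monic_phi L_orthogonal by (simp add: L_monic_phi)

text \<open>Gives meaning to the definite description in \<open>orth_poly\<close>. A nonzero
  difference \<open>d\<close> of degree \<open>m < n\<close> is orthogonal to
  \<open>monic_phi m\<close>, yet its top coefficient contributes \<open>lead_coeff d\<close> times
  the norm of \<open>monic_phi m\<close>. The positivity required is that of the norms of
  \<open>phi\<close>, known from their closed form.\<close>

lemma monic_orthogonal_unique: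
  assumes "monic_orthogonal (jacobi_weight a b) q"
  shows "q = monic_phi"
proof
  fix n
  have q: "degree (q k) = k" "lead_coeff (q k) = 1" and orth: "i \<noteq> j \<Longrightarrow> L (q i * q j) = 0" for k i j
    using assms unfolding monic_orthogonal_iff by blast+
  note p = degree_monic_phi lead_coeff_monic_phi
  have orth': "i \<noteq> j \<Longrightarrow> L (monic_phi i * monic_phi j) = 0" for i j
    by (simp add: L_monic_phi L_orthogonal)
  define d where "d = q n - monic_phi n"
  have d0: "coeff d i = 0" if "i \<ge> n" for i
    using that q(2)[of n] p(2)[of n] by (cases "i = n") (auto simp: d_def q(1) p(1) coeff_eq_0)
  have "d = 0"
  proof (rule ccontr)
    assume "d \<noteq> 0"
    define m where "m = degree d"
    have "m < n"
      using d0[of m] \<open>d \<noteq> 0\<close> unfolding m_def by (meson leading_coeff_0_iff not_le)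
    have low: "coeff (monic_phi m) i = 0" if "i \<ge> n" for i
      using that \<open>m < n\<close> p(1) by (simp add: coeff_eq_0)
    \<comment> \<open>The degree of \<open>monic_phi m\<close> is below \<open>n\<close>, so it is a
      combination of the \<open>q k\<close> with \<open>k < n\<close>.\<close>
    have "L (monic_phi m * q n) = 0"
      by (rule L_eq_0_of_lower[of q n]) (use q orth low in auto)
    moreover have "L (monic_phi m * monic_phi n) = 0"
      using \<open>m < n\<close> orth' by simp
    ultimately have "L (monic_phi m * q n - monic_phi m * monic_phi n) = 0"
      unfolding L_diff by simp
    also have "monic_phi m * q n - monic_phi m * monic_phi n = d * monic_phi m"
      unfolding d_def by (simp add: algebra_simps)
    finally have d_m: "L (d * monic_phi m) = 0" .
    define e where "e = d - smult (lead_coeff d) (monic_phi m)"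
    have e0: "coeff e i = 0" if "i \<ge> m" for i
    proof (cases "i = m")
      case True
      then show ?thesis
        using p(2)[of m] by (simp add: e_def p(1) flip: m_def)
    next
      case False
      then have "coeff d i = 0" "coeff (monic_phi m) i = 0"
        using that p(1) by (auto simp: m_def intro!: coeff_eq_0)
      then show ?thesis by (simp add: e_def)
    qed
    have "L (monic_phi k * monic_phi m) = 0" if "k < m" for k
      using orth' that by simp
    from L_eq_0_of_lower[of monic_phi, OF p this e0] have "L (e * monic_phi m) = 0" .
    moreover have "d * monic_phi m = e * monic_phi m + smult (lead_coeff d) (monic_phi m * monic_phi m)"
      unfolding e_def by (simp only: left_diff_distrib mult_smult_left diff_add_cancel)
    ultimately have "lead_coeff d * L (monic_phi m * monic_phi m) = 0"
      using d_m by (simp only: L_add L_smult add_0)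
    moreover have "L (monic_phi m * monic_phi m) > 0"
      unfolding L_monic_phi by (intro divide_pos_pos L_phi_pos) (simp flip: power2_eq_square)
    ultimately show False using \<open>d \<noteq> 0\<close> by simp
  qed
  then show "q n = monic_phi n" by (simp add: d_def)
qed

lemma orth_poly_eq: "orth_poly (jacobi_weight a b) = monic_phi"
  unfolding orth_poly_def
  by (rule the_equality) (fact monic_orthogonal_phi, rule monic_orthogonal_unique)

definition S :: "nat \<Rightarrow> real \<Rightarrow> real \<Rightarrow> real" where
  "S N x y = (\<Sum>n<N. r n * poly (phi n) x * poly (phi n) y)"

text \<open>The leading coefficients cancel between the squared norm and the two polynomial values,
  and \<open>L_norm\<close> replaces the remaining norm by
  \<open>Gamma (a + 1) ^ 2 / r n\<close>.\<close>

theorem jacobi_kernel_eq: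
  "jacobi_kernel a b N x y =
     sqrt (jacobi_weight a b x * jacobi_weight a b y) / Gamma (a + 1) ^ 2 * S N x y"
proof -
  have "1 / orth_norm (jacobi_weight a b) n * poly (monic_phi n) x * poly (monic_phi n) y =
      r n * poly (phi n) x * poly (phi n) y / Gamma (a + 1) ^ 2" for n
  proof -
    have "orth_norm (jacobi_weight a b) n = L (monic_phi n * monic_phi n)"
      by (simp add: orth_norm_def orth_poly_eq L_def mult.assoc)
    then have on: "orth_norm (jacobi_weight a b) n = L (phi n * phi n) / (lead_coeff (phi n) * lead_coeff (phi n))"
      unfolding L_monic_phi .
    have monic: "poly (monic_phi n) z = poly (phi n) z / lead_coeff (phi n)" for z
      by (simp add: monic_phi_def)
    have *: "1 / (l / (d * d)) * (u / d) * (v / d) = t * u * v / (t * l)"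
      if "d \<noteq> 0" "l > 0" "t > 0" for d l t u v :: real
      using that by (simp add: field_simps)
    show ?thesis
      unfolding L_norm[of n, symmetric] on monic
      by (rule *) (simp_all add: r_pos L_phi_pos)
  qed
  then have "(\<Sum>n<N. 1 / orth_norm (jacobi_weight a b) n * poly (monic_phi n) x * poly (monic_phi n) y) =
      S N x y / Gamma (a + 1) ^ 2"
    unfolding S_def sum_divide_distrib by (intro sum.cong refl)
  then show ?thesis
    unfolding jacobi_kernel_def corr_kernel_def orth_poly_eq by (simp only: times_divide_eq_left times_divide_eq_right)
qed

end

section \<open>Asymptotics of the Gamma factor\<close>

text \<open>Oddness excludes a quadratic term. The derivative of the difference is
  \<open>2 * x ^ 2 / (1 - x ^ 2)\<close>, at most \<open>4 * x ^ 2\<close> on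
  \<open>|x| <= 1 / 2\<close>.\<close>

lemma ln_ratio_expansion:
  "\<exists>C \<delta>. C \<ge> 0 \<and> \<delta> > 0 \<and> \<delta> < 1 \<and> (\<forall>x::real. \<bar>x\<bar> \<le> \<delta> \<longrightarrow> \<bar>ln ((1 + x) / (1 - x)) - 2 * x\<bar> \<le> C * \<bar>x\<bar> ^ 3)"
proof -
  have "\<bar>ln ((1 + x) / (1 - x)) - 2 * x\<bar> \<le> 4 * \<bar>x\<bar> ^ 3" if x: "\<bar>x\<bar> \<le> 1 / 2" for x :: real
  proof -
    let ?h = "\<lambda>x::real. ln (1 + x) - ln (1 - x) - 2 * x"
    let ?h' = "\<lambda>x::real. 2 * x ^ 2 / (1 - x ^ 2)"
    have "norm (?h x - ?h 0) \<le> 4 * x ^ 2 * norm (x - 0)"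
    proof (rule field_differentiable_bound[of "cball 0 \<bar>x\<bar>" ?h ?h'])
      fix y :: real assume "y \<in> cball 0 \<bar>x\<bar>"
      then have y: "\<bar>y\<bar> \<le> \<bar>x\<bar>" by (simp add: dist_norm)
      with x have y2: "- 1 < y" "y < 1" by auto
      have "y ^ 2 \<le> x ^ 2" using y by (simp add: abs_le_square_iff)
      have "x ^ 2 \<le> (1 / 2) ^ 2" using x by (intro abs_le_square_iff[THEN iffD1]) auto
      then have d: "1 - y ^ 2 \<ge> 1 / 2" using \<open>y ^ 2 \<le> x ^ 2\<close> by (simp add: power2_eq_square)
      have "1 - y ^ 2 = (1 - y) * (1 + y)" by algebra
      then have h': "?h' y = 1 / (1 + y) + 1 / (1 - y) - 2"
        using y2 by (simp add: divide_simps) (simp add: algebra_simps power2_eq_square)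
      show "(?h has_field_derivative ?h' y) (at y within cball 0 \<bar>x\<bar>)"
        unfolding h' using y2 by (auto intro!: derivative_eq_intros simp: divide_simps)
      have "y ^ 2 / (1 - y ^ 2) \<le> x ^ 2 / (1 / 2)"
        using d \<open>y ^ 2 \<le> x ^ 2\<close> by (intro frac_le) auto
      then show "norm (?h' y) \<le> 4 * x ^ 2"
        using d by simp
    qed auto
    moreover have "ln ((1 + x) / (1 - x)) = ln (1 + x) - ln (1 - x)"
      using x by (intro ln_divide_pos) (auto simp: abs_le_iff)
    ultimately show ?thesis by (simp add: power2_eq_square power3_eq_cube)
  qed
  then show ?thesis by (intro exI[of _ 4] exI[of _ "1/2"]) auto
qed

text \<open>The sequence \<open>2 * C / n ^ 2\<close> drops by at least \<open>C / n ^ 3\<close> in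
  each step. Added to \<open>q\<close> it gives a decreasing sequence, subtracted from
  \<open>q\<close> an increasing one; both tend to 0, which bounds \<open>q\<close> from both
  sides.\<close>

lemma abs_le_of_increment_le:
  fixes q :: "nat \<Rightarrow> real"
  assumes inc: "\<And>n. n \<ge> n0 \<Longrightarrow> \<bar>q (Suc n) - q n\<bar> \<le> C / real n ^ 3"
    and lim: "q \<longlonglongrightarrow> 0" and n: "n \<ge> n0" and n0: "n0 > 0"
  shows "\<bar>q n\<bar> \<le> 2 * C / real n ^ 2"
proof -
  have C: "C \<ge> 0"
  proof -
    have "0 \<le> C / real n0 ^ 3" using inc[of n0] by linarith
    then show ?thesis using n0 by (simp add: zero_le_divide_iff)
  qed
  have step: "C / real k ^ 3 \<le> 2 * C / real k ^ 2 - 2 * C / real (Suc k) ^ 2" if "k \<ge> n0" for k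
  proof -
    have k: "real k \<ge> 1" using that n0 by simp
    define x where "x = real k"
    have x: "x \<ge> 1" using k by (simp add: x_def)
    \<comment> \<open>The factor 2 is there for small \<open>x\<close>: without it the inequality
      fails at \<open>x = 1\<close>.\<close>
    have "x ^ 2 * (x + 1) ^ 2 \<le> x ^ 3 * (2 * (2 * x + 1))"
    proof -
      have "x ^ 3 * (2 * (2 * x + 1)) - x ^ 2 * (x + 1) ^ 2 = x ^ 2 * (3 * x ^ 2 - 1)"
        by algebra
      moreover have "3 * x ^ 2 - 1 \<ge> 0" using x one_le_power[of x 2] by linarith
      then have "0 \<le> x ^ 2 * (3 * x ^ 2 - 1)" by simp
      ultimately show ?thesis by linarith
    qed
    then have "1 / x ^ 3 \<le> 2 * (2 * x + 1) / (x ^ 2 * (x + 1) ^ 2)"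
      using x by (simp add: divide_simps mult_ac)
    also have "\<dots> = 2 / x ^ 2 - 2 / (x + 1) ^ 2"
      using x by (simp add: divide_simps) algebra
    finally have "C * (1 / x ^ 3) \<le> C * (2 / x ^ 2 - 2 / (x + 1) ^ 2)"
      using C by (rule mult_left_mono)
    then show ?thesis by (simp add: x_def algebra_simps)
  qed
  have lim0: "(\<lambda>n. 2 * C / real n ^ 2) \<longlonglongrightarrow> 0"
    by real_asymp
  have lim': "(\<lambda>k. q (k + n)) \<longlonglongrightarrow> 0" "(\<lambda>k. 2 * C / real (k + n) ^ 2) \<longlonglongrightarrow> 0"
    using LIMSEQ_ignore_initial_segment[OF lim, of n] LIMSEQ_ignore_initial_segment[OF lim0, of n] by auto
  have "decseq (\<lambda>k. q (k + n) + 2 * C / real (k + n) ^ 2)"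
    using inc step n by (intro decseq_SucI) (smt (verit) add_Suc trans_le_add2)
  from decseq_ge[OF this, of 0 0] have "q n + 2 * C / real n ^ 2 \<ge> 0"
    using tendsto_add[OF lim'] by simp
  moreover have "incseq (\<lambda>k. q (k + n) - 2 * C / real (k + n) ^ 2)"
    using inc step n by (intro incseq_SucI) (smt (verit) add_Suc trans_le_add2)
  from incseq_le[OF this, of 0 0] have "q n - 2 * C / real n ^ 2 \<le> 0"
    using tendsto_diff[OF lim'] by simp
  ultimately show ?thesis by linarith
qed

lemma Gamma_shift_asymp:
  fixes z :: real
  assumes "z > 0"
  shows "(\<lambda>n. Gamma (real n + z) / (fact (n - 1) * real n powr z)) \<longlonglongrightarrow> 1"
proof -
  have z: "z \<notin> \<int>\<^sub>\<le>\<^sub>0" "Gamma z > 0"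
    using assms by (auto dest: nonpos_Ints_nonpos intro: Gamma_real_pos)
  have "(\<lambda>n. Gamma z / Gamma_series' z n) \<longlonglongrightarrow> Gamma z / Gamma z"
    using z(2) by (intro tendsto_divide tendsto_const Gamma_series'_LIMSEQ) auto
  moreover have "\<forall>\<^sub>F n in sequentially. Gamma z / Gamma_series' z n = Gamma (real n + z) / (fact (n - 1) * real n powr z)"
    using eventually_gt_at_top[of 0]
  proof eventually_elim
    case (elim n)
    have "pochhammer z n > 0" using assms by (rule pochhammer_pos)
    moreover have "pochhammer z n = Gamma (z + real n) / Gamma z"
      using z(1) by (rule pochhammer_Gamma)
    ultimately show ?case
      using elim z(2) by (simp add: Gamma_series'_def powr_def field_simps)
  qed
  ultimately show ?thesis
    using z(2) tendsto_cong by force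
qed

context jacobi
begin

text \<open>Indexed by \<open>n = N - 1\<close>: this is \<open>N + (a + b) / 2\<close> for \<open>N = Suc n\<close>.\<close>
definition sigma :: "nat \<Rightarrow> real" where
  "sigma n = real n + (c + 1) / 2"

lemma sigma_pos: "sigma n > 0"
  using c_gt by (simp add: sigma_def add_nonneg_pos)

text \<open>The exponents add up as \<open>(c + 1) + (a + 2) - 1 - (b + 1) = 2 * a + 2\<close>. This
  fixes only the limit; the rate comes from \<open>ln_G_increment\<close>.\<close>

lemma G_limit: "(\<lambda>n. G (Suc n) / sigma n powr (2 * a + 2)) \<longlonglongrightarrow> 1"
proof -
  let ?R = "\<lambda>z n. Gamma (real n + z) / (fact (n - 1) * real n powr z)"
  have "(\<lambda>n. ?R (c + 1) n * ?R (a + 2) n / (?R 1 n * ?R (b + 1) n) * (real n / sigma n) powr (2 * a + 2))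
      \<longlonglongrightarrow> 1 * 1 / (1 * 1) * 1 powr (2 * a + 2)"
  proof (intro tendsto_mult tendsto_divide tendsto_powr tendsto_const Gamma_shift_asymp)
    show "(\<lambda>n. real n / sigma n) \<longlonglongrightarrow> 1"
      unfolding sigma_def by real_asymp
  qed (use a b c_gt in auto)
  moreover have "\<forall>\<^sub>F n in sequentially.
      ?R (c + 1) n * ?R (a + 2) n / (?R 1 n * ?R (b + 1) n) * (real n / sigma n) powr (2 * a + 2) =
      G (Suc n) / sigma n powr (2 * a + 2)"
    using eventually_gt_at_top[of 0]
  proof eventually_elim
    case (elim n)
    define x where "x = real n"
    have x: "x > 0" using elim by (simp add: x_def)
    have "x powr (c + 1) * x powr (a + 2) = x powr (2 * a + 2) * (x powr 1 * x powr (b + 1))"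
      by (simp only: powr_add[symmetric]) (simp add: c_def algebra_simps)
    moreover have "Gamma (x + 1) = fact n"
      using Gamma_fact[of n, where 'a = real] by (simp add: x_def add.commute)
    moreover have "Gamma (x + (b + 1)) > 0"
      using b x by (intro Gamma_real_pos) auto
    moreover have "x powr (c + 1) > 0" "x powr (a + 2) > 0" "x powr (2 * a + 2) > 0" "x powr (b + 1) > 0"
      using x by auto
    ultimately show ?case
      using sigma_pos[of n] x unfolding x_def[symmetric]
      by (simp add: G_def powr_divide field_simps flip: x_def)
  qed
  ultimately show ?thesis
    by (simp add: tendsto_cong)
qed

lemma ln_G_increment:
  "\<exists>C n0. n0 > 0 \<and> (\<forall>n\<ge>n0. \<bar>(ln (G (Suc (Suc n))) - (2 * a + 2) * ln (sigma (Suc n))) -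
      (ln (G (Suc n)) - (2 * a + 2) * ln (sigma n))\<bar> \<le> C / real n ^ 3)"
proof -
  obtain C \<delta> where C: "C \<ge> 0" "\<delta> > 0" "\<delta> < 1"
    and bd: "\<And>x::real. \<bar>x\<bar> \<le> \<delta> \<Longrightarrow> \<bar>ln ((1 + x) / (1 - x)) - 2 * x\<bar> \<le> C * \<bar>x\<bar> ^ 3"
    using ln_ratio_expansion by blast
  \<comment> \<open>\<open>m n\<close> is the midpoint of both pairs in the quotient of
    \<open>G_Suc\<close> and of the pair \<open>sigma n\<close>, \<open>sigma (Suc n)\<close>. The
    half-distances are \<open>c / 2\<close>, \<open>p\<close> and \<open>1 / 2\<close>.\<close>
  define m where "m n = real n + 1 + c / 2" for n
  define p where "p = (a - b + 1) / 2"
  define D where "D = C * (\<bar>c / 2\<bar> ^ 3 + \<bar>p\<bar> ^ 3 + \<bar>2 * a + 2\<bar> * \<bar>1 / 2\<bar> ^ 3)"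
  have ev: "\<forall>\<^sub>F n in sequentially. \<bar>t / m n\<bar> \<le> \<delta>" for t
  proof -
    have "(\<lambda>n. t / m n) \<longlonglongrightarrow> 0" unfolding m_def by real_asymp
    then have "\<forall>\<^sub>F n in sequentially. dist (t / m n) 0 < \<delta>" using C(2) by (rule tendstoD)
    then show ?thesis by eventually_elim simp
  qed
  have "\<forall>\<^sub>F n in sequentially. \<bar>(ln (G (Suc (Suc n))) - (2 * a + 2) * ln (sigma (Suc n))) -
      (ln (G (Suc n)) - (2 * a + 2) * ln (sigma n))\<bar> \<le> D / real n ^ 3"
    using ev[of "c / 2"] ev[of p] ev[of "1 / 2"] eventually_gt_at_top[of 0]
  proof eventually_elim
    case (elim n)
    have m: "m n > 0" "m n \<ge> real n" using c_gt by (auto simp: m_def)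
    have ratio: "(1 + t / m n) / (1 - t / m n) = (m n + t) / (m n - t)" for t
      using m(1) by (simp add: divide_simps)
    have main: "\<bar>ln ((m n + t) / (m n - t)) - 2 * (t / m n)\<bar> \<le> C * \<bar>t\<bar> ^ 3 / real n ^ 3"
      if "\<bar>t / m n\<bar> \<le> \<delta>" for t
    proof -
      have "C * \<bar>t / m n\<bar> ^ 3 \<le> C * (\<bar>t\<bar> / real n) ^ 3"
        using C(1) m elim by (intro mult_left_mono power_mono) (auto simp: abs_divide intro!: divide_left_mono mult_pos_pos)
      with bd[OF that] show ?thesis unfolding ratio by (simp add: power_divide)
    qed
    have 1: "m n + c / 2 = real n + 1 + c" "m n - c / 2 = real n + 1"
      "m n + p = real n + a + 2" "m n - p = real n + 1 + b"
      "m n + 1 / 2 = sigma (Suc n)" "m n - 1 / 2 = sigma n"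
      by (auto simp: m_def p_def c_def sigma_def field_simps)
    have pos: "real n + 1 + c > 0" "real n + a + 2 > 0" "real n + 1 > 0" "real n + 1 + b > 0" "G (Suc n) > 0"
      using a b c_gt G_pos by auto
    have "ln (G (Suc (Suc n)) * ((real n + 1) * (real n + 1 + b))) =
      ln (G (Suc n) * ((real n + 1 + c) * (real n + a + 2)))"
      by (simp only: G_Suc)
    then have "ln (G (Suc (Suc n))) - ln (G (Suc n)) =
      (ln (real n + 1 + c) - ln (real n + 1)) + (ln (real n + a + 2) - ln (real n + 1 + b))"
      using pos G_pos[of "Suc n"] by (simp add: ln_mult_pos)
    also have "\<dots> = ln ((m n + c / 2) / (m n - c / 2)) + ln ((m n + p) / (m n - p))"
      unfolding 1 using pos by (simp add: ln_div)
    finally have G: "ln (G (Suc (Suc n))) - ln (G (Suc n)) =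
        ln ((m n + c / 2) / (m n - c / 2)) + ln ((m n + p) / (m n - p))" .
    have S: "ln (sigma (Suc n)) - ln (sigma n) = ln ((m n + 1 / 2) / (m n - 1 / 2))"
      unfolding 1 using sigma_pos[of n] sigma_pos[of "Suc n"] by (simp add: ln_div)
    \<comment> \<open>Since \<open>c / 2 + p = a + 1\<close>, the exponent \<open>2 * a + 2\<close>
      is exactly the one for which the linear terms cancel.\<close>
    have lin: "2 * ((c / 2) / m n) + 2 * (p / m n) = (2 * a + 2) * (2 * ((1 / 2) / m n))"
      using m(1) by (simp add: p_def c_def field_simps)
    have M: "\<bar>(2 * a + 2) * (ln ((m n + 1 / 2) / (m n - 1 / 2)) - 2 * ((1 / 2) / m n))\<bar>
        \<le> \<bar>2 * a + 2\<bar> * (C * \<bar>1 / 2\<bar> ^ 3 / real n ^ 3)"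
      unfolding abs_mult by (intro mult_left_mono main elim) auto
    have "D / real n ^ 3 = C * \<bar>c / 2\<bar> ^ 3 / real n ^ 3 + C * \<bar>p\<bar> ^ 3 / real n ^ 3
        + \<bar>2 * a + 2\<bar> * (C * \<bar>1 / 2\<bar> ^ 3 / real n ^ 3)"
      by (simp add: D_def add_divide_distrib ring_distribs mult_ac)
    moreover have "(ln (G (Suc (Suc n))) - (2 * a + 2) * ln (sigma (Suc n))) -
      (ln (G (Suc n)) - (2 * a + 2) * ln (sigma n)) =
      (ln ((m n + c / 2) / (m n - c / 2)) - 2 * ((c / 2) / m n)) +
      (ln ((m n + p) / (m n - p)) - 2 * (p / m n)) -
      (2 * a + 2) * (ln ((m n + 1 / 2) / (m n - 1 / 2)) - 2 * ((1 / 2) / m n))"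
      using G S lin by algebra
    ultimately show ?case
      using main[OF elim(1)] main[OF elim(2)] M by linarith
  qed
  then obtain n0 where "\<And>n. n \<ge> n0 \<Longrightarrow> \<bar>(ln (G (Suc (Suc n))) - (2 * a + 2) * ln (sigma (Suc n))) -
      (ln (G (Suc n)) - (2 * a + 2) * ln (sigma n))\<bar> \<le> D / real n ^ 3"
    unfolding eventually_sequentially by blast
  then show ?thesis by (intro exI[of _ D] exI[of _ "Suc n0"]) auto
qed

lemma G_asymp: "(\<lambda>n. G (Suc n) / sigma n powr (2 * a + 2) - 1) \<in> O(\<lambda>n. 1 / sigma n ^ 2)"
proof -
  define q where "q n = ln (G (Suc n)) - (2 * a + 2) * ln (sigma n)" for n
  have q: "G (Suc n) / sigma n powr (2 * a + 2) = exp (q n)" for n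
    using G_pos[of n] sigma_pos[of n] by (simp add: q_def exp_diff powr_def)
  have "(\<lambda>n. ln (exp (q n))) \<longlonglongrightarrow> ln 1"
    using G_limit unfolding q by (intro tendsto_ln) auto
  then have lim: "q \<longlonglongrightarrow> 0" by simp
  obtain C n0 where n0: "n0 > 0" and C: "\<And>n. n \<ge> n0 \<Longrightarrow> \<bar>q (Suc n) - q n\<bar> \<le> C / real n ^ 3"
    using ln_G_increment unfolding q_def by blast
  have "q \<in> O(\<lambda>n. 1 / real n ^ 2)"
  proof (rule bigoI[of _ "2 * C"])
    show "\<forall>\<^sub>F n in sequentially. norm (q n) \<le> 2 * C * norm (1 / real n ^ 2)"
      using eventually_ge_at_top[of n0]
      by eventually_elim (use abs_le_of_increment_le[OF C lim _ n0] in auto)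
  qed
  also have "(\<lambda>n. 1 / real n ^ 2) \<in> O(\<lambda>n. 1 / sigma n ^ 2)"
    unfolding sigma_def by real_asymp
  finally have q1: "q \<in> O(\<lambda>n. 1 / sigma n ^ 2)" .
  have "(\<lambda>n. exp (q n) - 1) \<in> O(q)"
  proof (rule bigoI[of _ 2])
    have "\<forall>\<^sub>F n in sequentially. dist (q n) 0 < 1"
      using lim by (rule tendstoD) simp
    then show "\<forall>\<^sub>F n in sequentially. norm (exp (q n) - 1) \<le> 2 * norm (q n)"
    proof eventually_elim
      case (elim n)
      show ?case
      proof (cases "q n \<ge> 0")
        case True
        then show ?thesis using exp_bound[of "q n"] elim
          by (simp add: power2_eq_square) (smt (verit) mult_left_le_one_le one_le_exp_iff)
      next
        case False
        then have "norm (exp (q n) - 1) = 1 - exp (q n)" "norm (q n) = - q n" by simp_all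
        then show ?thesis using exp_ge_add_one_self[of "q n"] False by linarith
      qed
    qed
  qed
  with q1 show ?thesis unfolding q by (rule landau_o.big_trans[rotated])
qed

end

section \<open>The Bessel kernel\<close>

lemma tendsto_powr_at_right_0: "p > 0 \<Longrightarrow> ((\<lambda>t::real. t powr p) \<longlongrightarrow> 0) (at_right 0)"
  by real_asymp

context jacobi
begin

section \<open>Integrals against \<open>t powr a\<close> on the unit interval\<close>

definition weighted_int :: "(real \<Rightarrow> real) \<Rightarrow> real" where
  "weighted_int f = (LBINT t:{0<..<1}. t powr a * f t)"

lemma set_integrable_powr: "set_integrable lborel {0<..<1} (\<lambda>t::real. t powr a)"
proof -
  have "set_integrable lborel {0..1} (\<lambda>t. t powr (a + 1 - 1) * (1 - t) powr (1 - 1 :: real))"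
    using a by (intro integrable_Beta) auto
  then have "set_integrable lborel {0<..<1} (\<lambda>t. t powr (a + 1 - 1) * (1 - t) powr (1 - 1 :: real))"
    by (rule set_integrable_subset) auto
  also have "?this \<longleftrightarrow> ?thesis"
    by (intro set_integrable_cong) auto
  finally show ?thesis .
qed

lemma weighted_int_integrable:
  assumes "continuous_on {0..1} f"
  shows "set_integrable lborel {0<..<1} (\<lambda>t. t powr a * f t)"
proof -
  have "bounded (f ` {0..1})"
    using assms compact_Icc by (intro compact_imp_bounded compact_continuous_image)
  then obtain B where B: "\<And>t. t \<in> {0..1} \<Longrightarrow> \<bar>f t\<bar> \<le> B"
    by (force simp: bounded_iff)
  have m: "(\<lambda>t. indicator {0<..<1} t *\<^sub>R f t) \<in> borel_measurable lborel"
    using borel_measurable_continuous_on_indicator[of "{0<..<1}" f] continuous_on_subset[OF assms, of "{0<..<1}"]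
    by (auto simp: greaterThanLessThan_subseteq_atLeastAtMost_iff)
  show ?thesis
    unfolding set_integrable_def
  proof (rule Bochner_Integration.integrable_bound)
    show "integrable lborel (\<lambda>t. indicator {0<..<1} t *\<^sub>R t powr a * B)"
      using set_integrable_powr unfolding set_integrable_def by (rule integrable_mult_left)
    have "(\<lambda>t. t powr a * (indicator {0<..<1} t *\<^sub>R f t)) \<in> borel_measurable lborel"
      by (rule borel_measurable_times[OF _ m]) measurable
    then show "(\<lambda>t. indicator {0<..<1} t *\<^sub>R (t powr a * f t)) \<in> borel_measurable lborel"
      by (simp add: mult.left_commute)
    have "norm (indicator {0<..<1} t *\<^sub>R (t powr a * f t)) \<le> norm (indicator {0<..<1} t *\<^sub>R t powr a * B)" for t
      using B[of t] by (auto simp: indicator_def abs_mult intro!: mult_left_mono)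
    then show "AE t in lborel. norm (indicator {0<..<1} t *\<^sub>R (t powr a * f t)) \<le> norm (indicator {0<..<1} t *\<^sub>R t powr a * B)"
      by simp
  qed
qed

lemma weighted_int_add:
  assumes "continuous_on {0..1} f" "continuous_on {0..1} g"
  shows "weighted_int (\<lambda>t. f t + g t) = weighted_int f + weighted_int g"
  unfolding weighted_int_def distrib_left by (intro set_integral_add weighted_int_integrable assms)

lemma weighted_int_cmult: "weighted_int (\<lambda>t. k * f t) = k * weighted_int f"
  unfolding weighted_int_def mult.left_commute[of _ k] by (rule set_integral_mult_right)

text \<open>The weighted integrand is the derivative of \<open>t powr (a + 1) * f t\<close>, whose
  boundary value at 0 vanishes because \<open>a > -1\<close>. The Euler, Lommel and scaling
  identities for \<open>h\<close> are all instances.\<close>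

lemma weighted_int_FTC:
  assumes f: "\<And>t. (f has_real_derivative f' t) (at t)" and f': "continuous_on UNIV f'"
  shows "weighted_int (\<lambda>t. (a + 1) * f t + t * f' t) = f 1"
proof -
  have cf: "continuous_on S f" for S
    using f by (meson DERIV_continuous_on has_field_derivative_at_within)
  have cf': "continuous_on S f'" for S
    using f' continuous_on_subset by blast
  let ?F = "\<lambda>t. t powr (a + 1) * f t"
  let ?g = "\<lambda>t. t powr a * ((a + 1) * f t + t * f' t)"
  have lim0: "(?F \<longlongrightarrow> 0) (at_right 0)"
  proof -
    have "(?F \<longlongrightarrow> 0 * f 0) (at_right 0)"
      using cf[of UNIV] a
      by (intro tendsto_mult tendsto_powr_at_right_0) (auto simp: continuous_on_def intro: tendsto_within_subset)
    then show ?thesis by simp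
  qed
  have lim1: "(?F \<longlongrightarrow> f 1) (at_left 1)"
  proof -
    have "(?F \<longlongrightarrow> 1 powr (a + 1) * f 1) (at_left 1)"
      using cf[of UNIV]
      by (intro tendsto_mult tendsto_powr tendsto_ident_at tendsto_const) (auto simp: continuous_on_def intro: tendsto_within_subset)
    then show ?thesis by simp
  qed
  have der: "(?F has_real_derivative ?g t) (at t)" if "t > 0" for t
  proof -
    have "t powr (a + 1) = t * t powr a" using that by (simp add: powr_add)
    then show ?thesis
      using that by (auto intro!: derivative_eq_intros f simp: algebra_simps)
  qed
  have cont: "isCont ?g t" if "t > 0" for t
    using that cf[of UNIV] f' by (intro continuous_intros) (auto simp: continuous_on_eq_continuous_at)
  have "(LBINT t=ereal 0..ereal 1. ?g t) = f 1 - 0"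
  proof (rule interval_integral_FTC_integrable)
    show "set_integrable lborel (einterval (ereal 0) (ereal 1)) ?g"
      using weighted_int_integrable[of "\<lambda>t. (a + 1) * f t + t * f' t"] cf cf'
      by (simp add: continuous_intros)
  qed (use der cont lim0 lim1 in \<open>auto simp: has_real_derivative_iff_has_vector_derivative ereal_tendsto_simps\<close>)
  then show ?thesis
    by (simp add: weighted_int_def interval_lebesgue_integral_def)
qed

text \<open>Dominated convergence along an arbitrary null sequence \<open>X\<close>. As
  \<open>X\<close> is bounded and \<open>t < 1\<close>, all arguments of \<open>f\<close> lie in one
  compact interval, and the maximum \<open>K\<close> of the derivative there dominates the
  difference quotients.\<close>

lemma weighted_int_has_derivative:
  assumes f: "\<And>t. (f has_real_derivative f' t) (at t)" and f': "continuous_on UNIV f'"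
    and g: "continuous_on {0..1} g"
  shows "((\<lambda>x. weighted_int (\<lambda>t. f (x * t) * g t)) has_real_derivative weighted_int (\<lambda>t. t * f' (x * t) * g t)) (at x)"
proof -
  have cf: "continuous_on S f" for S
    using f by (meson DERIV_continuous_on has_field_derivative_at_within)
  have cf': "continuous_on S f'" for S
    using f' continuous_on_subset by blast
  define I where "I x = weighted_int (\<lambda>t. f (x * t) * g t)" for x
  have int: "set_integrable lborel {0<..<1} (\<lambda>t. t powr a * (f (y * t) * g t))" for y
    by (intro weighted_int_integrable continuous_intros g continuous_on_compose2[OF cf[of UNIV]]) auto
  have int': "set_integrable lborel {0<..<1} (\<lambda>t. t powr a * (t * f' (y * t) * g t))" for y
    by (intro weighted_int_integrable continuous_intros g continuous_on_compose2[OF cf'[of UNIV]]) auto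
  have "(\<lambda>i. (I (x + X i) - I x) / X i) \<longlonglongrightarrow> weighted_int (\<lambda>t. t * f' (x * t) * g t)"
    if X: "\<And>i. X i \<noteq> 0" "X \<longlonglongrightarrow> 0" for X
  proof -
    have "Bseq X"
      using X(2) by (intro convergent_imp_Bseq convergentI)
    then obtain B where B: "\<And>i. \<bar>X i\<bar> \<le> B"
      by (auto simp: Bseq_def)
    have "bounded (f' ` {-(\<bar>x\<bar> + B)..\<bar>x\<bar> + B})"
      using cf' by (intro compact_imp_bounded compact_continuous_image) auto
    then obtain K where K: "\<And>y. \<bar>y\<bar> \<le> \<bar>x\<bar> + B \<Longrightarrow> \<bar>f' y\<bar> \<le> K"
      by (force simp: bounded_iff)
    have lip: "\<bar>f ((x + X i) * t) - f (x * t)\<bar> \<le> K * \<bar>X i\<bar>" if t: "0 < t" "t < 1" for i t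
    proof -
      have xt: "\<bar>y * t\<bar> \<le> \<bar>y\<bar>" for y using t by (simp add: abs_mult mult_left_le)
      have "norm (f ((x + X i) * t) - f (x * t)) \<le> K * norm ((x + X i) * t - x * t)"
      proof (rule field_differentiable_bound[of "{-(\<bar>x\<bar> + B)..\<bar>x\<bar> + B}" f f'])
        show "(x + X i) * t \<in> {- (\<bar>x\<bar> + B)..\<bar>x\<bar> + B}"
          using xt[of "x + X i"] B[of i] by auto
        show "x * t \<in> {- (\<bar>x\<bar> + B)..\<bar>x\<bar> + B}"
          using xt[of x] B[of i] by auto
      qed (use K in \<open>auto intro: has_field_derivative_at_within[OF f]\<close>)
      also have "(x + X i) * t - x * t = X i * t" by algebra
      also have "K * norm (X i * t) \<le> K * \<bar>X i\<bar>"
        using xt[of "X i"] K[of x] B[of i] abs_ge_zero[of "f' x"] by (intro mult_left_mono) (simp_all, linarith)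
      finally show ?thesis by simp
    qed
    have "(\<lambda>i. \<integral>t. indicator {0<..<1} t *\<^sub>R (t powr a * ((f ((x + X i) * t) - f (x * t)) / X i * g t)) \<partial>lborel)
       \<longlonglongrightarrow> (\<integral>t. indicator {0<..<1} t *\<^sub>R (t powr a * (t * f' (x * t) * g t)) \<partial>lborel)"
    proof (rule integral_dominated_convergence[where w = "\<lambda>t. indicator {0<..<1} t *\<^sub>R (t powr a * (K * \<bar>g t\<bar>))"])
      show "integrable lborel (\<lambda>t. indicator {0<..<1} t *\<^sub>R (t powr a * (K * \<bar>g t\<bar>)))"
        using weighted_int_integrable[of "\<lambda>t. K * \<bar>g t\<bar>"] g unfolding set_integrable_def
        by (simp add: continuous_intros)
      show "(\<lambda>t. indicator {0<..<1} t *\<^sub>R (t powr a * (t * f' (x * t) * g t))) \<in> borel_measurable lborel"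
        using int'[of x] unfolding set_integrable_def by (rule borel_measurable_integrable)
      show "(\<lambda>t. indicator {0<..<1} t *\<^sub>R (t powr a * ((f ((x + X i) * t) - f (x * t)) / X i * g t))) \<in> borel_measurable lborel" for i
      proof -
        have "set_integrable lborel {0<..<1} (\<lambda>t. t powr a * ((f ((x + X i) * t) - f (x * t)) / X i * g t))"
          using X(1) by (intro weighted_int_integrable continuous_intros g continuous_on_compose2[OF cf[of UNIV]]) auto
        then show ?thesis unfolding set_integrable_def by (rule borel_measurable_integrable)
      qed
      show "AE t in lborel. (\<lambda>i. indicator {0<..<1} t *\<^sub>R (t powr a * ((f ((x + X i) * t) - f (x * t)) / X i * g t)))
          \<longlonglongrightarrow> indicator {0<..<1} t *\<^sub>R (t powr a * (t * f' (x * t) * g t))"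
      proof (intro AE_I2 tendsto_scaleR tendsto_mult tendsto_const)
        fix t
        have "((\<lambda>y. f (y * t)) has_real_derivative t * f' (x * t)) (at x)"
          by (rule DERIV_chain2[OF f, THEN DERIV_cong]) (auto intro!: derivative_eq_intros)
        then have "((\<lambda>h. (f ((x + h) * t) - f (x * t)) / h) \<longlongrightarrow> t * f' (x * t)) (at 0)"
          by (simp add: DERIV_def)
        then show "(\<lambda>i. (f ((x + X i) * t) - f (x * t)) / X i) \<longlonglongrightarrow> t * f' (x * t)"
          using X by (auto simp: tendsto_at_iff_sequentially comp_def)
      qed
      show "AE t in lborel. norm (indicator {0<..<1} t *\<^sub>R (t powr a * ((f ((x + X i) * t) - f (x * t)) / X i * g t)))
          \<le> indicator {0<..<1} t *\<^sub>R (t powr a * (K * \<bar>g t\<bar>))" for i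
      proof (rule AE_I2)
        fix t :: real
        show "norm (indicator {0<..<1} t *\<^sub>R (t powr a * ((f ((x + X i) * t) - f (x * t)) / X i * g t)))
          \<le> indicator {0<..<1} t *\<^sub>R (t powr a * (K * \<bar>g t\<bar>))"
        proof (cases "0 < t \<and> t < 1")
          case True
          define q where "q = (f ((x + X i) * t) - f (x * t)) / X i"
          have "\<bar>q\<bar> \<le> K"
            using lip[of t i] X(1)[of i] True by (simp add: q_def abs_divide divide_simps)
          then show ?thesis
            using True unfolding q_def[symmetric] by (simp add: abs_mult mult_left_mono mult_right_mono)
        qed simp
      qed
    qed
    moreover have "(\<integral>t. indicator {0<..<1} t *\<^sub>R (t powr a * ((f ((x + X i) * t) - f (x * t)) / X i * g t)) \<partial>lborel)
       = (I (x + X i) - I x) / X i" for i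
    proof -
      have "I (x + X i) - I x = (LBINT t:{0<..<1}. t powr a * (f ((x + X i) * t) * g t) - t powr a * (f (x * t) * g t))"
        unfolding I_def weighted_int_def by (rule set_integral_diff(2)[symmetric]) (rule int)+
      then show ?thesis
        unfolding set_lebesgue_integral_def
        by (simp add: algebra_simps diff_divide_distrib flip: integral_divide_zero)
    qed
    ultimately show ?thesis
      unfolding weighted_int_def set_lebesgue_integral_def by (simp only:)
  qed
  then show ?thesis
    unfolding I_def[symmetric] DERIV_def by (auto simp: tendsto_at_iff_sequentially comp_def)
qed

section \<open>The entire factor of the Bessel function and its differential equation\<close>

lemma summable_bcoeff_poly:
  assumes C: "C \<ge> 1" and R: "R \<ge> 0"
  shows "summable (\<lambda>k. (real k + C) ^ p * \<bar>bcoeff k\<bar> * R ^ k)"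
proof (rule summable_ratio_test[of "1 / 2" "nat \<lceil>2 * 2 ^ p * R\<rceil> + 1"])
  \<comment> \<open>Because \<open>real (Suc k) + C <= 2 * (real k + C)\<close>, successive terms
    have quotient at most \<open>2 ^ p * R / d\<close> with \<open>d\<close> at least
    \<open>real k\<close>; beyond the threshold this is at most 1/2.\<close>
  fix k assume k: "k \<ge> nat \<lceil>2 * 2 ^ p * R\<rceil> + 1"
  then have k1: "real k \<ge> 1" "real k \<ge> 2 * 2 ^ p * R" by linarith+
  define d where "d = (real k + 1) * (a + 1 + real k)"
  have "d \<ge> (2 * 2 ^ p * R) * 1"
    unfolding d_def using k1 a R by (intro mult_mono) auto
  then have d: "2 ^ p * R \<le> d / 2" by simp
  have d0: "d > 0" unfolding d_def using a k1 by simp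
  have "bcoeff (Suc k) * d = - bcoeff k"
    using bcoeff_Suc[of k] by (simp add: d_def mult_ac)
  then have "\<bar>bcoeff (Suc k) * d\<bar> = \<bar>bcoeff k\<bar>" by simp
  then have b: "\<bar>bcoeff k\<bar> = \<bar>bcoeff (Suc k)\<bar> * d" using d0 by (simp add: abs_mult)
  have "(real (Suc k) + C) ^ p \<le> (2 * (real k + C)) ^ p"
    using C by (intro power_mono) auto
  then have "(real (Suc k) + C) ^ p \<le> 2 ^ p * (real k + C) ^ p"
    unfolding power_mult_distrib by simp
  then have "(real (Suc k) + C) ^ p * (\<bar>bcoeff (Suc k)\<bar> * R ^ Suc k) \<le>
      2 ^ p * (real k + C) ^ p * (\<bar>bcoeff (Suc k)\<bar> * R ^ Suc k)"
    using R by (intro mult_right_mono) auto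
  also have "\<dots> = ((real k + C) ^ p * \<bar>bcoeff (Suc k)\<bar> * R ^ k) * (2 ^ p * R)"
    by simp
  also have "\<dots> \<le> ((real k + C) ^ p * \<bar>bcoeff (Suc k)\<bar> * R ^ k) * (d / 2)"
    using R C by (intro mult_left_mono d) auto
  also have "\<dots> = 1 / 2 * ((real k + C) ^ p * \<bar>bcoeff k\<bar> * R ^ k)"
    unfolding b by simp
  finally show "norm ((real (Suc k) + C) ^ p * \<bar>bcoeff (Suc k)\<bar> * R ^ Suc k)
      \<le> 1 / 2 * norm ((real k + C) ^ p * \<bar>bcoeff k\<bar> * R ^ k)"
    using R C by (simp add: abs_mult mult_ac)
qed simp

lemma summable_bcoeff: "summable (\<lambda>k. bcoeff k * u ^ k)"
proof (rule summable_norm_cancel)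
  show "summable (\<lambda>k. norm (bcoeff k * u ^ k))"
    using summable_bcoeff_poly[of 1 "\<bar>u\<bar>" 0] by (simp add: abs_mult power_abs)
qed

text \<open>
  \<open>bes (x / 4)\<close> is \<open>J\<^sub>a(\<surd>x)\<close> up to the factor \<open>(x / 4) powr (a / 2) / Gamma (a + 1)\<close>; unlike \<open>J\<^sub>a\<close> it
  is entire.
\<close>
definition bes :: "real \<Rightarrow> real" where "bes u = (\<Sum>k. bcoeff k * u ^ k)"
definition bes1 :: "real \<Rightarrow> real" where "bes1 u = (\<Sum>k. diffs bcoeff k * u ^ k)"
definition bes2 :: "real \<Rightarrow> real" where "bes2 u = (\<Sum>k. diffs (diffs bcoeff) k * u ^ k)"

lemma summable_bcoeff1: "summable (\<lambda>k. diffs bcoeff k * u ^ k)"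
  by (rule termdiff_converges_all) (rule summable_bcoeff)

lemma summable_bcoeff2: "summable (\<lambda>k. diffs (diffs bcoeff) k * u ^ k)"
  by (rule termdiff_converges_all) (rule summable_bcoeff1)

lemma bes_deriv: "(bes has_real_derivative bes1 u) (at u)"
  unfolding bes_def[abs_def] bes1_def
  by (rule termdiffs_strong_converges_everywhere) (rule summable_bcoeff)

lemma bes1_deriv: "(bes1 has_real_derivative bes2 u) (at u)"
  unfolding bes1_def[abs_def] bes2_def
  by (rule termdiffs_strong_converges_everywhere) (rule summable_bcoeff1)

lemma bes2_isCont: "isCont bes2 u"
  unfolding bes2_def[abs_def]
  by (rule isCont_powser_converges_everywhere) (rule summable_bcoeff2)

lemma bes_deriv' [derivative_intros]:
  "(f has_real_derivative f') (at x within X) \<Longrightarrow>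
     ((\<lambda>x. bes (f x)) has_real_derivative bes1 (f x) * f') (at x within X)"
  using DERIV_chain2[OF bes_deriv] .

lemma bes1_deriv' [derivative_intros]:
  "(f has_real_derivative f') (at x within X) \<Longrightarrow>
     ((\<lambda>x. bes1 (f x)) has_real_derivative bes2 (f x) * f') (at x within X)"
  using DERIV_chain2[OF bes1_deriv] .

lemma continuous_on_bes [continuous_intros]:
  "continuous_on X f \<Longrightarrow> continuous_on X (\<lambda>x. bes (f x))"
  by (rule continuous_on_compose2[of UNIV bes]) (auto intro!: DERIV_continuous_on[OF bes_deriv])

lemma continuous_on_bes1 [continuous_intros]:
  "continuous_on X f \<Longrightarrow> continuous_on X (\<lambda>x. bes1 (f x))"
  by (rule continuous_on_compose2[of UNIV bes1]) (auto intro!: DERIV_continuous_on[OF bes1_deriv])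

lemma continuous_on_bes2 [continuous_intros]:
  "continuous_on X f \<Longrightarrow> continuous_on X (\<lambda>x. bes2 (f x))"
  by (rule continuous_on_compose2[of UNIV bes2])
    (auto intro: continuous_at_imp_continuous_on bes2_isCont)

text \<open>Bessel's equation for \<open>J\<^sub>a(z)\<close> in the variable
  \<open>u = z^2 / 4\<close>, with the power factor removed. On coefficients it is the recursion
  \<open>bcoeff_Suc\<close>.\<close>

lemma bes_ODE: "u * bes2 u + (a + 1) * bes1 u + bes u = 0"
proof -
  have 2: "(\<lambda>k. real k * diffs bcoeff k * u ^ k) sums (u * bes2 u)"
  proof -
    have "(\<lambda>k. u * (diffs (diffs bcoeff) k * u ^ k)) sums (u * bes2 u)"
      unfolding bes2_def by (intro sums_mult summable_sums summable_bcoeff2)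
    also have "(\<lambda>k. u * (diffs (diffs bcoeff) k * u ^ k)) = (\<lambda>k. real (Suc k) * diffs bcoeff (Suc k) * u ^ Suc k)"
      by (simp add: diffs_def fun_eq_iff)
    finally show ?thesis
      using sums_Suc_iff[of "\<lambda>k. real k * diffs bcoeff k * u ^ k" "u * bes2 u"] by simp
  qed
  have "(\<lambda>k. real k * diffs bcoeff k * u ^ k + (a + 1) * (diffs bcoeff k * u ^ k) + bcoeff k * u ^ k)
      sums (u * bes2 u + (a + 1) * bes1 u + bes u)"
    unfolding bes_def bes1_def
    by (intro sums_add sums_mult 2 summable_sums summable_bcoeff summable_bcoeff1)
  moreover have "real k * diffs bcoeff k * u ^ k + (a + 1) * (diffs bcoeff k * u ^ k) + bcoeff k * u ^ k = 0" for k
  proof -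
    have "real k * diffs bcoeff k * u ^ k + (a + 1) * (diffs bcoeff k * u ^ k) + bcoeff k * u ^ k =
        (bcoeff (Suc k) * (real k + 1) * (a + 1 + real k) + bcoeff k) * u ^ k"
      by (simp add: diffs_def algebra_simps)
    then show ?thesis unfolding bcoeff_Suc by simp
  qed
  ultimately have "(\<lambda>k. 0) sums (u * bes2 u + (a + 1) * bes1 u + bes u)"
    by simp
  from sums_unique2[OF this sums_zero] show ?thesis .
qed

section \<open>The Bessel kernel without its power factor\<close>

definition h :: "real \<Rightarrow> real \<Rightarrow> real" where
  "h u v = weighted_int (\<lambda>t. bes (u * t) * bes (v * t))"

definition h1 :: "real \<Rightarrow> real \<Rightarrow> real" where
  "h1 u v = weighted_int (\<lambda>t. t * bes1 (u * t) * bes (v * t))"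

lemma h_commute: "h u v = h v u"
  by (simp add: h_def mult.commute)

lemma h_deriv: "((\<lambda>u. h u v) has_real_derivative h1 u v) (at u)"
  unfolding h_def h1_def
  by (rule weighted_int_has_derivative) (auto intro!: bes_deriv continuous_intros)

text \<open>Integrates the derivative of \<open>t powr (a + 1) * bes (u * t) * bes (v * t)\<close>.
  The boundary term at 1 is the reason why the Euler operator turns the kernel into a product of two
  Bessel functions.\<close>

lemma h_euler: "u * h1 u v + v * h1 v u + (a + 1) * h u v = bes u * bes v"
proof -
  let ?f = "\<lambda>t. bes (u * t) * bes (v * t)"
  let ?f' = "\<lambda>t. u * bes1 (u * t) * bes (v * t) + v * bes1 (v * t) * bes (u * t)"
  have "weighted_int (\<lambda>t. (a + 1) * ?f t + t * ?f' t) = ?f 1"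
    by (rule weighted_int_FTC) (auto intro!: derivative_eq_intros continuous_intros)
  also have "(\<lambda>t. (a + 1) * ?f t + t * ?f' t) =
     (\<lambda>t. (a + 1) * ?f t + (u * (t * bes1 (u * t) * bes (v * t)) + v * (t * bes1 (v * t) * bes (u * t))))"
    by (simp add: algebra_simps)
  also have "weighted_int \<dots> = (a + 1) * h u v + (u * h1 u v + v * h1 v u)"
    unfolding h_def h1_def by (simp add: weighted_int_add weighted_int_cmult continuous_intros)
  finally show ?thesis by simp
qed

text \<open>The Christoffel-Darboux formula of the limit, with \<open>u * bes1 u\<close> in the role
  of \<open>dphi\<close> and \<open>bes\<close> in that of \<open>phi\<close>. Under the integral
  the products of two \<open>bes1\<close> cancel and the differential equation eliminates
  \<open>bes2\<close>.\<close>

lemma h_lommel: "(u - v) * h u v = - (u * bes1 u * bes v - v * bes1 v * bes u)"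
proof -
  let ?f = "\<lambda>t. u * bes1 (u * t) * bes (v * t) - v * bes1 (v * t) * bes (u * t)"
  let ?f' = "\<lambda>t. u ^ 2 * bes2 (u * t) * bes (v * t) - v ^ 2 * bes2 (v * t) * bes (u * t)"
  have "weighted_int (\<lambda>t. (a + 1) * ?f t + t * ?f' t) = ?f 1"
    by (rule weighted_int_FTC) (auto intro!: derivative_eq_intros continuous_intros simp: power2_eq_square algebra_simps)
  also have "(\<lambda>t. (a + 1) * ?f t + t * ?f' t) = (\<lambda>t. (v - u) * (bes (u * t) * bes (v * t)))"
  proof
    fix t
    show "(a + 1) * ?f t + t * ?f' t = (v - u) * (bes (u * t) * bes (v * t))"
      using bes_ODE[of "u * t"] bes_ODE[of "v * t"] by algebra
  qed
  also have "weighted_int \<dots> = (v - u) * h u v"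
    unfolding h_def by (rule weighted_int_cmult)
  finally show ?thesis by (simp add: algebra_simps)
qed

text \<open>Substituting \<open>s = l * t\<close> shows why: the function is the integral of
  \<open>s powr a * bes (u * s) * bes (v * s)\<close> over \<open>0 < s < l\<close>. The proof gets
  the same by differentiating under the integral and applying \<open>weighted_int_FTC\<close>.
  Working along the ray moves both arguments at once.\<close>

lemma h_scale_deriv:
  assumes "l > 0"
  shows "((\<lambda>l. l powr (a + 1) * h (l * u) (l * v)) has_real_derivative
           l powr a * (bes (l * u) * bes (l * v))) (at l)"
proof -
  let ?f = "\<lambda>z. bes (u * z) * bes (v * z)"
  let ?f' = "\<lambda>z. u * bes1 (u * z) * bes (v * z) + v * bes1 (v * z) * bes (u * z)"
  have f: "(?f has_real_derivative ?f' z) (at z)" for z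
    by (auto intro!: derivative_eq_intros)
  have f': "continuous_on X ?f'" for X
    by (intro continuous_intros)
  have h: "h (l * u) (l * v) = weighted_int (\<lambda>t. ?f (l * t) * 1)" for l
    by (simp add: h_def mult_ac)
  have d: "((\<lambda>l. h (l * u) (l * v)) has_real_derivative weighted_int (\<lambda>t. t * ?f' (l * t) * 1)) (at l)"
    unfolding h by (rule weighted_int_has_derivative[OF f f']) (rule continuous_on_const)
  have "weighted_int (\<lambda>t. (a + 1) * ?f (l * t) + t * (?f' (l * t) * l)) = ?f (l * 1)"
    by (rule weighted_int_FTC) (auto intro!: derivative_eq_intros continuous_intros simp: algebra_simps)
  also have "(\<lambda>t. (a + 1) * ?f (l * t) + t * (?f' (l * t) * l)) =
     (\<lambda>t. (a + 1) * (?f (l * t) * 1) + l * (t * ?f' (l * t) * 1))"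
    by (simp add: mult_ac)
  also have "weighted_int \<dots> = (a + 1) * h (l * u) (l * v) + l * weighted_int (\<lambda>t. t * ?f' (l * t) * 1)"
    unfolding h by (subst weighted_int_add) (auto intro!: continuous_intros simp: weighted_int_cmult)
  finally have *: "(a + 1) * h (l * u) (l * v) + l * weighted_int (\<lambda>t. t * ?f' (l * t) * 1) = bes (l * u) * bes (l * v)"
    by (simp add: mult.commute)
  have p: "l powr (a + 1) = l powr a * l"
    using assms by (simp add: powr_add)
  show ?thesis
    using assms by (auto intro!: derivative_eq_intros d simp: p *[symmetric]) (simp add: algebra_simps)
qed

end

section \<open>Uniform approximation of the kernel\<close>

text \<open>
  The Lipschitz part of the bound is what survives the division by \<open>u - v\<close> in the
  Christoffel--Darboux formula, uniformly up to the diagonal.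
\<close>
definition lip_bounded :: "real \<Rightarrow> real \<Rightarrow> (real \<Rightarrow> real) \<Rightarrow> bool" where
  "lip_bounded R B f \<longleftrightarrow> (\<forall>u\<in>{0..R}. \<forall>v\<in>{0..R}. \<bar>f u\<bar> \<le> B \<and> \<bar>f u - f v\<bar> \<le> B * \<bar>u - v\<bar>)"

lemma lip_boundedD:
  assumes "lip_bounded R B f" "u \<in> {0..R}" "v \<in> {0..R}"
  shows "\<bar>f u\<bar> \<le> B" "\<bar>f u - f v\<bar> \<le> B * \<bar>u - v\<bar>"
  using assms unfolding lip_bounded_def by auto

lemma lip_bounded_add:
  assumes "lip_bounded R A f" "lip_bounded R B g"
  shows "lip_bounded R (A + B) (\<lambda>u. f u + g u)"
  unfolding lip_bounded_def
proof (intro ballI conjI)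
  fix u v assume uv: "u \<in> {0..R}" "v \<in> {0..R}"
  note * = lip_boundedD[OF assms(1) uv] lip_boundedD[OF assms(2) uv]
  show "\<bar>f u + g u\<bar> \<le> A + B" using * by linarith
  have "(A + B) * \<bar>u - v\<bar> = A * \<bar>u - v\<bar> + B * \<bar>u - v\<bar>" by algebra
  then show "\<bar>(f u + g u) - (f v + g v)\<bar> \<le> (A + B) * \<bar>u - v\<bar>" using * by linarith
qed

lemma lip_bounded_mono: "lip_bounded R A f \<Longrightarrow> A \<le> B \<Longrightarrow> lip_bounded R B f"
  unfolding lip_bounded_def by (meson abs_ge_zero mult_right_mono order_trans)

text \<open>Inserting \<open>f v * g v\<close> puts a difference between \<open>u\<close> and
  \<open>v\<close> into each term. The resulting factor \<open>|u - v|\<close> is the one that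
  Christoffel-Darboux divides by.\<close>

lemma lip_bounded_wronskian:
  assumes "lip_bounded R A f" "lip_bounded R B g" "u \<in> {0..R}" "v \<in> {0..R}"
  shows "\<bar>f u * g v - g u * f v\<bar> \<le> 2 * A * B * \<bar>u - v\<bar>"
proof -
  note f = lip_boundedD[OF assms(1,3,4)] lip_boundedD[OF assms(1,4,3)] and g = lip_boundedD[OF assms(2,3,4)] lip_boundedD[OF assms(2,4,3)]
  have "\<bar>(f u - f v) * g v\<bar> \<le> (A * \<bar>u - v\<bar>) * B"
    unfolding abs_mult using f g by (intro mult_mono order_trans[OF abs_ge_zero]) auto
  moreover have "\<bar>(g u - g v) * f v\<bar> \<le> (B * \<bar>u - v\<bar>) * A"
    unfolding abs_mult using f g by (intro mult_mono order_trans[OF abs_ge_zero]) auto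
  moreover have "f u * g v - g u * f v = (f u - f v) * g v - (g u - g v) * f v"
    by algebra
  ultimately have "\<bar>f u * g v - g u * f v\<bar> \<le> (A * \<bar>u - v\<bar>) * B + (B * \<bar>u - v\<bar>) * A"
    by linarith
  then show ?thesis by (simp add: algebra_simps)
qed

lemma abs_power_diff_le:
  fixes u v R :: real
  assumes "u \<in> {0..R}" "v \<in> {0..R}" "R \<ge> 1"
  shows "\<bar>u ^ k - v ^ k\<bar> \<le> real k * R ^ k * \<bar>u - v\<bar>"
proof (induction k)
  case (Suc k)
  have "u ^ Suc k - v ^ Suc k = u * (u ^ k - v ^ k) + (u - v) * v ^ k"
    by (simp add: algebra_simps)
  also have "\<bar>\<dots>\<bar> \<le> \<bar>u * (u ^ k - v ^ k)\<bar> + \<bar>(u - v) * v ^ k\<bar>"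
    by (rule abs_triangle_ineq)
  also have "\<bar>u * (u ^ k - v ^ k)\<bar> \<le> R * (real k * R ^ k * \<bar>u - v\<bar>)"
    unfolding abs_mult using assms Suc by (intro mult_mono) auto
  also have "\<bar>(u - v) * v ^ k\<bar> \<le> \<bar>u - v\<bar> * R ^ Suc k"
  proof -
    have "v ^ k \<le> R ^ k" using assms by (intro power_mono) auto
    also have "R ^ k \<le> R ^ Suc k" using assms by (intro power_increasing) auto
    finally show ?thesis
      using assms by (auto simp: abs_mult intro!: mult_left_mono)
  qed
  finally show ?case by (simp add: algebra_simps)
qed simp

context jacobi
begin

section \<open>Termwise comparison of power series\<close>

definition coeff_shift :: real where "coeff_shift = \<bar>c\<bar> + 2"

text \<open>Four powers of the weight absorb the coefficient errors of order
  \<open>1 / sigma n ^ 2\<close>; the fifth pays for the factor \<open>k\<close> in the Lipschitz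
  constant of \<open>u ^ k\<close>. The shift lets \<open>real k + coeff_shift\<close> dominate the
  terms with \<open>(c + 1) / 2\<close> and \<open>c - 1\<close> as well.\<close>

definition W :: "real \<Rightarrow> real" where
  "W R = (\<Sum>k. (real k + coeff_shift) ^ 5 * \<bar>bcoeff k\<bar> * R ^ k)"

lemma coeff_shift_ge: "coeff_shift \<ge> 2"
  by (simp add: coeff_shift_def)

lemma W_summable: "R \<ge> 0 \<Longrightarrow> summable (\<lambda>k. (real k + coeff_shift) ^ 5 * \<bar>bcoeff k\<bar> * R ^ k)"
  using coeff_shift_ge by (intro summable_bcoeff_poly) auto

lemma W_nonneg: "R \<ge> 0 \<Longrightarrow> W R \<ge> 0"
  unfolding W_def using coeff_shift_ge by (intro suminf_nonneg W_summable) auto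

lemma powser_lip_bounded:
  assumes f: "\<And>k. \<bar>f k\<bar> \<le> K * ((real k + coeff_shift) ^ 4 * \<bar>bcoeff k\<bar>)" and R: "R \<ge> 1" and K: "K \<ge> 0"
  shows "\<And>u. u \<in> {0..R} \<Longrightarrow> summable (\<lambda>k. f k * u ^ k)"
    and "lip_bounded R (K * W R) (\<lambda>u. \<Sum>k. f k * u ^ k)"
proof -
  define w where "w k = K * ((real k + coeff_shift) ^ 5 * \<bar>bcoeff k\<bar> * R ^ k)" for k
  have w: "summable w" "suminf w = K * W R"
    using W_summable[of R] R unfolding w_def W_def
    by (auto intro!: summable_mult suminf_mult)
  have f1: "\<bar>f k\<bar> * (real k + coeff_shift) * R ^ k \<le> w k" for k
  proof -
    have "\<bar>f k\<bar> * ((real k + coeff_shift) * R ^ k) \<le> K * ((real k + coeff_shift) ^ 4 * \<bar>bcoeff k\<bar>) * ((real k + coeff_shift) * R ^ k)"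
      using f[of k] R coeff_shift_ge by (intro mult_right_mono) auto
    also have "\<dots> = w k" by (simp add: w_def eval_nat_numeral)
    finally show ?thesis by (simp add: mult.assoc)
  qed
  have f0: "\<bar>f k * u ^ k\<bar> \<le> w k" if "u \<in> {0..R}" for u k
  proof -
    have "\<bar>f k * u ^ k\<bar> \<le> \<bar>f k\<bar> * R ^ k"
      using that by (auto simp: abs_mult power_abs intro!: mult_left_mono power_mono)
    also have "\<dots> \<le> \<bar>f k\<bar> * R ^ k * (real k + coeff_shift)"
      using R coeff_shift_ge mult_left_mono[of 1 "real k + coeff_shift" "\<bar>f k\<bar> * R ^ k"] by simp
    also have "\<dots> \<le> w k" using f1[of k] by (simp add: mult_ac)
    finally show ?thesis .
  qed
  show sm: "summable (\<lambda>k. f k * u ^ k)" if "u \<in> {0..R}" for u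
    by (rule summable_comparison_test'[OF w(1), of 0]) (use f0 that in auto)
  have f2: "\<bar>f k * u ^ k - f k * v ^ k\<bar> \<le> w k * \<bar>u - v\<bar>" if "u \<in> {0..R}" "v \<in> {0..R}" for u v k
  proof -
    have "\<bar>f k * u ^ k - f k * v ^ k\<bar> = \<bar>f k\<bar> * \<bar>u ^ k - v ^ k\<bar>"
      by (simp add: abs_mult flip: right_diff_distrib)
    also have "\<dots> \<le> \<bar>f k\<bar> * (real k * R ^ k * \<bar>u - v\<bar>)"
      using that R by (intro mult_left_mono abs_power_diff_le) auto
    also have "\<dots> \<le> (\<bar>f k\<bar> * (real k + coeff_shift) * R ^ k) * \<bar>u - v\<bar>"
      using R coeff_shift_ge by (simp add: algebra_simps)
    also have "\<dots> \<le> w k * \<bar>u - v\<bar>" by (intro mult_right_mono f1) auto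
    finally show ?thesis .
  qed
  show "lip_bounded R (K * W R) (\<lambda>u. \<Sum>k. f k * u ^ k)"
    unfolding lip_bounded_def
  proof (intro ballI conjI)
    fix u v assume uv: "u \<in> {0..R}" "v \<in> {0..R}"
    have "norm (\<Sum>k. f k * u ^ k) \<le> suminf w"
      by (rule norm_suminf_le[OF _ w(1)]) (use f0 uv in auto)
    then show "\<bar>\<Sum>k. f k * u ^ k\<bar> \<le> K * W R" using w(2) by simp
    have "norm (\<Sum>k. f k * u ^ k - f k * v ^ k) \<le> (\<Sum>k. w k * \<bar>u - v\<bar>)"
      by (rule norm_suminf_le) (use f2 uv w(1) in \<open>auto intro: summable_mult2\<close>)
    then show "\<bar>(\<Sum>k. f k * u ^ k) - (\<Sum>k. f k * v ^ k)\<bar> \<le> K * W R * \<bar>u - v\<bar>"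
      using suminf_diff[OF sm[OF uv(1)] sm[OF uv(2)]] suminf_mult2[OF w(1), of "\<bar>u - v\<bar>"] w(2) by simp
  qed
qed

definition e :: "nat \<Rightarrow> nat \<Rightarrow> real" where
  "e n k = E n k / sigma n ^ (2 * k)"

lemma e_eq: "e n k = (\<Prod>i<k. 1 - ((real i + (c + 1) / 2) / sigma n) ^ 2)"
proof (induction k)
  case (Suc k)
  have "(real n - real k) * (real n + 1 + c + real k) = sigma n ^ 2 - (real k + (c + 1) / 2) ^ 2"
    by (simp add: sigma_def power2_eq_square field_simps)
  then have "e n (Suc k) = e n k * ((sigma n ^ 2 - (real k + (c + 1) / 2) ^ 2) / sigma n ^ 2)"
    by (simp add: e_def E_Suc power2_eq_square)
  also have "(sigma n ^ 2 - (real k + (c + 1) / 2) ^ 2) / sigma n ^ 2 = 1 - ((real k + (c + 1) / 2) / sigma n) ^ 2"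
    using sigma_pos[of n] by (simp add: diff_divide_distrib power_divide)
  finally show ?case by (simp add: Suc.IH)
qed (simp add: e_def)

text \<open>By \<open>e_eq\<close> this is a product of factors \<open>1 - z i\<close>, which lie
  between 0 and 1 for \<open>i <= n\<close>, and one minus such a product is at most the sum of the
  \<open>z i\<close>. These are quadratic in \<open>1 / sigma n\<close>, hence so is the
  error.\<close>

lemma e_bounds: "e n k \<le> 1" "e n k \<ge> 0" "1 - e n k \<le> real k * (real k + coeff_shift) ^ 2 / sigma n ^ 2"
proof -
  define z where "z i = ((real i + (c + 1) / 2) / sigma n) ^ 2" for i
  have z0: "z i \<ge> 0" for i by (simp add: z_def)
  have z1: "z i \<le> 1" if "i \<le> n" for i
  proof -
    have "(real i + (c + 1) / 2) / sigma n \<le> 1" "(real i + (c + 1) / 2) / sigma n \<ge> 0"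
      using that sigma_pos[of n] c_gt by (auto simp: sigma_def divide_simps)
    then show ?thesis unfolding z_def by (intro power_le_one)
  qed
  have e: "e n k = (\<Prod>i<k. 1 - z i)" for k by (simp add: e_eq z_def)
  have zs: "(\<Sum>i<k. z i) \<le> real k * (real k + coeff_shift) ^ 2 / sigma n ^ 2"
  proof -
    have "z i \<le> (real k + coeff_shift) ^ 2 / sigma n ^ 2" if "i < k" for i
    proof -
      have "(real i + (c + 1) / 2) ^ 2 \<le> (real k + coeff_shift) ^ 2"
        using that c_gt abs_ge_self[of c] abs_ge_zero[of c] unfolding coeff_shift_def
        by (intro power_mono) (simp_all add: field_simps)
      then show ?thesis by (simp add: z_def power_divide divide_right_mono)
    qed
    then have "(\<Sum>i<k. z i) \<le> (\<Sum>i<k. (real k + coeff_shift) ^ 2 / sigma n ^ 2)"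
      by (intro sum_mono) auto
    then show ?thesis by simp
  qed
  have main: "0 \<le> e n k \<and> e n k \<le> 1 \<and> 1 - e n k \<le> (\<Sum>i<k. z i)"
  proof (cases "k \<le> n")
    case True
    then show ?thesis
    proof (induction k)
      case (Suc k)
      then have IH: "0 \<le> e n k" "e n k \<le> 1" "1 - e n k \<le> (\<Sum>i<k. z i)" by auto
      have zk: "0 \<le> z k" "z k \<le> 1" using z0 z1 Suc.prems by auto
      have eS: "e n (Suc k) = e n k * (1 - z k)" by (simp add: e)
      have "e n k * z k \<le> 1 * z k" using IH zk by (intro mult_right_mono) auto
      moreover have "0 \<le> e n k * (1 - z k)" using IH zk by simp
      moreover have "e n k * z k \<ge> 0" using IH zk by simp
      ultimately show ?case using IH by (simp add: eS algebra_simps)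
    qed (simp add: e)
  next
    case False
    \<comment> \<open>Beyond the degree the product is 0; the bound persists because the sum now
      contains \<open>z n = 1\<close>.\<close>
    then have "e n k = 0" by (simp add: e_def E_eq_0)
    moreover have "z n = 1" using sigma_pos[of n] by (simp add: z_def sigma_def)
    then have "1 \<le> (\<Sum>i<k. z i)"
      using False member_le_sum[of n "{..<k}" z] z0 by auto
    ultimately show ?thesis by simp
  qed
  then show "e n k \<le> 1" "e n k \<ge> 0" "1 - e n k \<le> real k * (real k + coeff_shift) ^ 2 / sigma n ^ 2"
    using zs by auto
qed

text \<open>The limit is \<open>u * bes1 u\<close>. The extra \<open>sigma n ^ 2\<close> compensates
  that the coefficient of degree \<open>Suc j\<close> carries only \<open>E n j\<close>.\<close>

definition dphi_scaled :: "nat \<Rightarrow> real \<Rightarrow> real" where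
  "dphi_scaled n u = sigma n ^ 2 * poly (dphi n) (u / sigma n ^ 2)"

definition phi_mean_scaled :: "nat \<Rightarrow> real \<Rightarrow> real" where
  "phi_mean_scaled n u = (poly (phi (Suc n)) (u / sigma n ^ 2) + poly (phi n) (u / sigma n ^ 2)) / 2"

lemma poly_sums: "(\<lambda>k. coeff p k * x ^ k) sums poly p (x :: real)"
  unfolding poly_altdef by (rule sums_finite) (auto simp: coeff_eq_0)

lemma dphi_scaled_sums: "(\<lambda>k. (case k of 0 \<Rightarrow> 0 | Suc j \<Rightarrow> real k * bcoeff k * e n j) * u ^ k) sums dphi_scaled n u"
proof -
  have "(\<lambda>k. sigma n ^ 2 * (coeff (dphi n) k * (u / sigma n ^ 2) ^ k)) sums dphi_scaled n u"
    unfolding dphi_scaled_def by (intro sums_mult poly_sums)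
  also have "(\<lambda>k. sigma n ^ 2 * (coeff (dphi n) k * (u / sigma n ^ 2) ^ k)) =
     (\<lambda>k. (case k of 0 \<Rightarrow> 0 | Suc j \<Rightarrow> real k * bcoeff k * e n j) * u ^ k)"
  proof
    fix k
    show "sigma n ^ 2 * (coeff (dphi n) k * (u / sigma n ^ 2) ^ k) =
      (case k of 0 \<Rightarrow> 0 | Suc j \<Rightarrow> real k * bcoeff k * e n j) * u ^ k"
      using sigma_pos[of n]
      by (cases k) (simp_all add: coeff_dphi_Suc e_def power_divide power_mult power2_eq_square power_mult_distrib add_ac)
  qed
  finally show ?thesis .
qed

lemma phi_mean_scaled_sums:
  "(\<lambda>k. (case k of 0 \<Rightarrow> 1 | Suc j \<Rightarrow>
      bcoeff k * e n j * (1 - ((c - 1) ^ 2 / 4 + real k * (c - 1) / 2) / sigma n ^ 2)) * u ^ k) sums phi_mean_scaled n u"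
proof -
  have "(\<lambda>k. coeff (smult (1 / 2) (phi (Suc n) + phi n)) k * (u / sigma n ^ 2) ^ k) sums phi_mean_scaled n u"
    using poly_sums[of "smult (1 / 2) (phi (Suc n) + phi n)" "u / sigma n ^ 2"] by (simp add: phi_mean_scaled_def)
  also have "(\<lambda>k. coeff (smult (1 / 2) (phi (Suc n) + phi n)) k * (u / sigma n ^ 2) ^ k) =
     (\<lambda>k. (case k of 0 \<Rightarrow> 1 | Suc j \<Rightarrow>
      bcoeff k * e n j * (1 - ((c - 1) ^ 2 / 4 + real k * (c - 1) / 2) / sigma n ^ 2)) * u ^ k)"
  proof
    fix k
    show "coeff (smult (1 / 2) (phi (Suc n) + phi n)) k * (u / sigma n ^ 2) ^ k =
      (case k of 0 \<Rightarrow> 1 | Suc j \<Rightarrow>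
        bcoeff k * e n j * (1 - ((c - 1) ^ 2 / 4 + real k * (c - 1) / 2) / sigma n ^ 2)) * u ^ k"
    proof (cases k)
      case (Suc j)
      let ?\<kappa> = "(c - 1) ^ 2 / 4 + real k * (c - 1) / 2"
      have "coeff (smult (1 / 2) (phi (Suc n) + phi n)) k = bcoeff k * ((A (Suc n) (Suc j) + A n (Suc j)) / 2)"
        by (simp add: coeff_phi Suc algebra_simps)
      also have "\<dots> = bcoeff k * (E n j * (sigma n ^ 2 - ?\<kappa>))"
        unfolding A_mean sigma_def Suc by (simp add: add_ac)
      finally have "coeff (smult (1 / 2) (phi (Suc n) + phi n)) k * (u / sigma n ^ 2) ^ k =
        bcoeff k * (E n j / sigma n ^ (2 * j)) * ((sigma n ^ 2 - ?\<kappa>) / sigma n ^ 2) * u ^ k"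
        by (simp add: Suc power_divide mult_ac flip: power_mult)
      also have "(sigma n ^ 2 - ?\<kappa>) / sigma n ^ 2 = 1 - ?\<kappa> / sigma n ^ 2"
        using sigma_pos[of n] by (simp add: diff_divide_distrib)
      finally show ?thesis by (simp add: Suc e_def)
    qed (simp add: coeff_phi)
  qed
  finally show ?thesis .
qed

end

text \<open>Carries the estimates obtained for \<open>u \<noteq> v\<close> to the diagonal:
  \<open>u\<close> tends to \<open>v\<close> from above, and \<open>v < R\<close> leaves room for
  it.\<close>

lemma diagonal_bound:
  fixes f :: "real \<Rightarrow> real"
  assumes "isCont f v" "v < R" "\<And>u. v < u \<Longrightarrow> u < R \<Longrightarrow> \<bar>f u\<bar> \<le> B"
  shows "\<bar>f v\<bar> \<le> B"
proof (rule tendsto_upperbound)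
  show "((\<lambda>u. \<bar>f u\<bar>) \<longlongrightarrow> \<bar>f v\<bar>) (at_right v)"
    using assms(1) by (intro tendsto_rabs) (auto simp: isCont_def intro: tendsto_within_subset)
  show "\<forall>\<^sub>F u in at_right v. \<bar>f u\<bar> \<le> B"
    using assms(2,3) by (auto simp: eventually_at_right)
qed simp

lemma divide_square_le:
  assumes "0 \<le> y" "1 \<le> (s :: real)"
  shows "y / s ^ 2 \<le> y"
  using one_le_power[OF assms(2), of 2] mult_left_mono[of 1 "s ^ 2" y] assms by (auto simp: divide_le_eq)

context jacobi
begin

section \<open>Errors of order \<open>1 / sigma n ^ 2\<close>, up to the diagonal\<close>

lemma lip_bounded_u_bes1: assumes R: "R \<ge> 1" shows "lip_bounded R (W R) (\<lambda>u. u * bes1 u)"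
proof -
  have s: "(\<lambda>k. real k * bcoeff k * u ^ k) sums (u * bes1 u)" for u
  proof -
    have "(\<lambda>k. u * (diffs bcoeff k * u ^ k)) sums (u * bes1 u)"
      unfolding bes1_def by (intro sums_mult summable_sums summable_bcoeff1)
    also have "(\<lambda>k. u * (diffs bcoeff k * u ^ k)) = (\<lambda>k. real (Suc k) * bcoeff (Suc k) * u ^ Suc k)"
      by (simp add: diffs_def fun_eq_iff)
    finally show ?thesis
      using sums_Suc_iff[of "\<lambda>k. real k * bcoeff k * u ^ k" "u * bes1 u"] by simp
  qed
  have "lip_bounded R (1 * W R) (\<lambda>u. \<Sum>k. real k * bcoeff k * u ^ k)"
  proof (rule powser_lip_bounded(2))
    fix k
    have "real k * 1 \<le> (real k + coeff_shift) * (real k + coeff_shift) ^ 3"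
      using coeff_shift_ge by (intro mult_mono one_le_power) auto
    then have "real k \<le> (real k + coeff_shift) ^ 4" by (simp add: eval_nat_numeral)
    then show "\<bar>real k * bcoeff k\<bar> \<le> 1 * ((real k + coeff_shift) ^ 4 * \<bar>bcoeff k\<bar>)"
      by (simp add: abs_mult mult_right_mono)
  qed (use R in auto)
  then show ?thesis
    using sums_unique[OF s] by simp
qed

lemma lip_bounded_bes: assumes R: "R \<ge> 1" shows "lip_bounded R (W R) bes"
proof -
  have "lip_bounded R (1 * W R) (\<lambda>u. \<Sum>k. bcoeff k * u ^ k)"
  proof (rule powser_lip_bounded(2))
    fix k
    have "1 * \<bar>bcoeff k\<bar> \<le> (real k + coeff_shift) ^ 4 * \<bar>bcoeff k\<bar>"
      using coeff_shift_ge by (intro mult_right_mono one_le_power) auto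
    then show "\<bar>bcoeff k\<bar> \<le> 1 * ((real k + coeff_shift) ^ 4 * \<bar>bcoeff k\<bar>)" by simp
  qed (use R in auto)
  then show ?thesis by (simp add: bes_def[abs_def])
qed

lemma lip_bounded_dphi_scaled: assumes R: "R \<ge> 1" shows "lip_bounded R (W R / sigma n ^ 2) (\<lambda>u. dphi_scaled n u - u * bes1 u)"
proof -
  let ?f = "\<lambda>k. (case k of 0 \<Rightarrow> 0 | Suc j \<Rightarrow> real k * bcoeff k * e n j) - real k * bcoeff k"
  have s: "(\<lambda>k. ?f k * u ^ k) sums (dphi_scaled n u - u * bes1 u)" for u
  proof -
    have "(\<lambda>k. u * (diffs bcoeff k * u ^ k)) sums (u * bes1 u)"
      unfolding bes1_def by (intro sums_mult summable_sums summable_bcoeff1)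
    also have "(\<lambda>k. u * (diffs bcoeff k * u ^ k)) = (\<lambda>k. real (Suc k) * bcoeff (Suc k) * u ^ Suc k)"
      by (simp add: diffs_def fun_eq_iff)
    finally have "(\<lambda>k. real k * bcoeff k * u ^ k) sums (u * bes1 u)"
      using sums_Suc_iff[of "\<lambda>k. real k * bcoeff k * u ^ k" "u * bes1 u"] by simp
    from sums_diff[OF dphi_scaled_sums this] show ?thesis
      by (simp only: left_diff_distrib)
  qed
  have "lip_bounded R (1 / sigma n ^ 2 * W R) (\<lambda>u. \<Sum>k. ?f k * u ^ k)"
  proof (rule powser_lip_bounded(2))
    fix k
    show "\<bar>?f k\<bar> \<le> 1 / sigma n ^ 2 * ((real k + coeff_shift) ^ 4 * \<bar>bcoeff k\<bar>)"
    proof (cases k)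
      case (Suc j)
      have "?f k = - (real k * bcoeff k * (1 - e n j))" by (simp add: Suc algebra_simps)
      then have "\<bar>?f k\<bar> = \<bar>bcoeff k\<bar> * (real k * (1 - e n j))"
        using e_bounds(1)[of n j] by (simp add: abs_mult)
      also have "\<dots> \<le> \<bar>bcoeff k\<bar> * ((real k + coeff_shift) ^ 4 / sigma n ^ 2)"
      proof -
        have "real j * (real j + coeff_shift) ^ 2 \<le> (real k + coeff_shift) * (real k + coeff_shift) ^ 2"
          using coeff_shift_ge Suc by (intro mult_mono power_mono) auto
        also have "\<dots> = (real k + coeff_shift) ^ 3" by (simp add: eval_nat_numeral)
        finally have "1 - e n j \<le> (real k + coeff_shift) ^ 3 / sigma n ^ 2"
          using e_bounds(3)[of n j] divide_right_mono[of "real j * (real j + coeff_shift) ^ 2" "(real k + coeff_shift) ^ 3" "sigma n ^ 2"]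
          by simp
        then have "real k * (1 - e n j) \<le> (real k + coeff_shift) * ((real k + coeff_shift) ^ 3 / sigma n ^ 2)"
          using coeff_shift_ge e_bounds(1)[of n j] by (intro mult_mono) auto
        then show ?thesis by (intro mult_left_mono) (auto simp: eval_nat_numeral)
      qed
      finally show ?thesis by (simp add: mult_ac)
    qed simp
  qed (use R in auto)
  then show ?thesis
    using sums_unique[OF s] by simp
qed

lemma lip_bounded_phi_mean_scaled: assumes R: "R \<ge> 1" shows "lip_bounded R (W R / sigma n ^ 2) (\<lambda>u. phi_mean_scaled n u - bes u)"
proof -
  let ?f = "\<lambda>k. (case k of 0 \<Rightarrow> 1 | Suc j \<Rightarrow>
      bcoeff k * e n j * (1 - ((c - 1) ^ 2 / 4 + real k * (c - 1) / 2) / sigma n ^ 2)) - bcoeff k"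
  have s: "(\<lambda>k. ?f k * u ^ k) sums (phi_mean_scaled n u - bes u)" for u
    using sums_diff[OF phi_mean_scaled_sums[of n u] summable_sums[OF summable_bcoeff[of u]]]
    unfolding bes_def by (simp only: left_diff_distrib)
  have "lip_bounded R (1 / sigma n ^ 2 * W R) (\<lambda>u. \<Sum>k. ?f k * u ^ k)"
  proof (rule powser_lip_bounded(2))
    fix k
    show "\<bar>?f k\<bar> \<le> 1 / sigma n ^ 2 * ((real k + coeff_shift) ^ 4 * \<bar>bcoeff k\<bar>)"
    proof (cases k)
      case 0
      then show ?thesis using coeff_shift_ge by simp
    next
      case (Suc j)
      \<comment> \<open>The amount by which the bracket in \<open>A_mean\<close> falls short of
        \<open>sigma n ^ 2\<close>, at \<open>k = Suc j\<close>.\<close>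
      define \<kappa> where "\<kappa> = (c - 1) ^ 2 / 4 + real k * (c - 1) / 2"
      define x where "x = real k + coeff_shift"
      have x: "x \<ge> 3" "\<bar>c - 1\<bar> \<le> x" "real k \<le> x" using coeff_shift_ge Suc by (auto simp: x_def coeff_shift_def)
      have "\<bar>\<kappa>\<bar> \<le> \<bar>c - 1\<bar> * \<bar>c - 1\<bar> / 4 + real k * \<bar>c - 1\<bar> / 2"
        unfolding \<kappa>_def by (rule order_trans[OF abs_triangle_ineq]) (simp add: power2_eq_square abs_mult)
      also have "\<dots> \<le> x * x / 4 + x * x / 2"
        using x by (intro add_mono divide_right_mono mult_mono) auto
      also have "\<dots> \<le> x ^ 2" by (simp add: power2_eq_square)
      finally have \<kappa>: "\<bar>\<kappa>\<bar> \<le> x ^ 2" .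
      have "real j * (real j + coeff_shift) ^ 2 \<le> x * x ^ 2"
        using coeff_shift_ge Suc unfolding x_def by (intro mult_mono power_mono) auto
      then have e1: "1 - e n j \<le> x * x ^ 2 / sigma n ^ 2"
        using e_bounds(3)[of n j] divide_right_mono[of "real j * (real j + coeff_shift) ^ 2" "x * x ^ 2" "sigma n ^ 2"]
        by simp
      have "e n j * \<bar>\<kappa>\<bar> \<le> 1 * x ^ 2"
        using e_bounds(1,2)[of n j] \<kappa> by (intro mult_mono) auto
      then have e2: "\<bar>e n j * \<kappa> / sigma n ^ 2\<bar> \<le> x ^ 2 / sigma n ^ 2"
        using e_bounds(2)[of n j] by (simp add: abs_mult divide_right_mono)
      have "\<bar>(1 - e n j) + e n j * \<kappa> / sigma n ^ 2\<bar> \<le> x * x ^ 2 / sigma n ^ 2 + x ^ 2 / sigma n ^ 2"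
        using e1 e2 e_bounds(1)[of n j] by linarith
      also have "\<dots> = (x * x ^ 2 + x ^ 2) / sigma n ^ 2" by (simp add: add_divide_distrib)
      also have "\<dots> \<le> x ^ 4 / sigma n ^ 2"
      proof -
        have "x + 1 \<le> x * x" using x(1) mult_right_mono[of 3 x x] by linarith
        then have "(x + 1) * x ^ 2 \<le> (x * x) * x ^ 2" by (intro mult_right_mono) auto
        then show ?thesis by (intro divide_right_mono) (auto simp: eval_nat_numeral algebra_simps)
      qed
      finally have e3: "\<bar>(1 - e n j) + e n j * \<kappa> / sigma n ^ 2\<bar> \<le> x ^ 4 / sigma n ^ 2" .
      have "?f k = - (bcoeff k * ((1 - e n j) + e n j * \<kappa> / sigma n ^ 2))"
        by (simp add: Suc \<kappa>_def algebra_simps)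
      then have "\<bar>?f k\<bar> = \<bar>bcoeff k\<bar> * \<bar>(1 - e n j) + e n j * \<kappa> / sigma n ^ 2\<bar>"
        by (simp add: abs_mult)
      also have "\<dots> \<le> \<bar>bcoeff k\<bar> * (x ^ 4 / sigma n ^ 2)"
        by (intro mult_left_mono e3) auto
      finally show ?thesis by (simp add: x_def mult_ac)
    qed
  qed (use R in auto)
  then show ?thesis
    using sums_unique[OF s] by simp
qed

text \<open>The mean of \<open>phi n\<close> and \<open>phi (Suc n)\<close> differs from
  \<open>phi n\<close> by \<open>sigma n\<close> times \<open>dphi n\<close>, which a Wronskian with
  \<open>dphi n\<close> does not see. Only after this exchange are all coefficients even in
  \<open>sigma n\<close>.\<close>

lemma S_wronskian:
  "(u - v) * S (Suc n) (u / sigma n ^ 2) (v / sigma n ^ 2) = - G (Suc n) * (dphi_scaled n u * phi_mean_scaled n v - phi_mean_scaled n u * dphi_scaled n v)"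
proof -
  let ?s = "sigma n ^ 2"
  have s: "?s > 0" using sigma_pos[of n] by simp
  have "(u - v) * S (Suc n) (u / ?s) (v / ?s) = ?s * ((u / ?s - v / ?s) * S (Suc n) (u / ?s) (v / ?s))"
    using s by (simp add: diff_divide_distrib[symmetric])
  also have "\<dots> = - G (Suc n) * (dphi_scaled n u * poly (phi n) (v / ?s) - poly (phi n) (u / ?s) * dphi_scaled n v)"
    unfolding S_def christoffel_darboux dphi_scaled_def by (simp add: algebra_simps)
  also have "dphi_scaled n u * poly (phi n) (v / ?s) - poly (phi n) (u / ?s) * dphi_scaled n v = dphi_scaled n u * phi_mean_scaled n v - phi_mean_scaled n u * dphi_scaled n v"
    unfolding dphi_scaled_def phi_mean_scaled_def phi_Suc by (simp add: field_simps)
  finally show ?thesis .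
qed

lemma S_isCont: "isCont (\<lambda>u. S N (u / s) y) v"
  unfolding S_def divide_inverse by (intro continuous_intros)

lemma h_isCont: "isCont (\<lambda>u. h u v) u"
  using h_deriv by (rule DERIV_isCont)

lemma h_bound:
  assumes R: "R \<ge> 1" and uv: "u \<in> {0..<R}" "v \<in> {0..<R}"
  shows "\<bar>h u v\<bar> \<le> 2 * W R * W R"
proof -
  have off: "\<bar>h u v\<bar> \<le> 2 * W R * W R" if "u \<noteq> v" "u \<in> {0..<R}" for u
  proof -
    have "\<bar>u - v\<bar> * \<bar>h u v\<bar> = \<bar>(u * bes1 u) * bes v - bes u * (v * bes1 v)\<bar>"
      unfolding abs_mult[symmetric] h_lommel by (subst abs_minus) (simp add: mult_ac)
    also have "\<dots> \<le> 2 * W R * W R * \<bar>u - v\<bar>"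
      using that uv by (intro lip_bounded_wronskian[OF lip_bounded_u_bes1[OF R] lip_bounded_bes[OF R]]) auto
    finally show ?thesis using that by (simp add: mult.commute)
  qed
  show ?thesis
  proof (cases "u = v")
    case True
    show ?thesis unfolding True
      by (rule diagonal_bound[OF h_isCont, of _ R]) (use off uv in auto)
  qed (use off uv in auto)
qed

lemma S_approx:
  assumes R: "R \<ge> 1" and s: "sigma n \<ge> 1" and uv: "u \<in> {0..<R}" "v \<in> {0..<R}"
  shows "\<bar>S (Suc n) (u / sigma n ^ 2) (v / sigma n ^ 2) / G (Suc n) - h u v\<bar> \<le> 6 * (W R)\<^sup>2 / sigma n ^ 2"
proof -
  let ?D = "\<lambda>u. S (Suc n) (u / sigma n ^ 2) (v / sigma n ^ 2) / G (Suc n) - h u v"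
  have W: "W R \<ge> 0" "W R / sigma n ^ 2 \<le> W R"
    using W_nonneg[of R] R s by (auto intro!: divide_square_le)
  have gn2: "lip_bounded R (2 * W R) (phi_mean_scaled n)"
    using lip_bounded_add[OF lip_bounded_phi_mean_scaled[OF R, of n] lip_bounded_bes[OF R]] W by (auto intro: lip_bounded_mono)
  have off: "\<bar>?D u\<bar> \<le> 6 * (W R)\<^sup>2 / sigma n ^ 2" if "u \<noteq> v" "u \<in> {0..<R}" for u
  proof -
    have u: "u \<in> {0..R}" "v \<in> {0..R}" using that uv by auto
    have "(u - v) * ?D u = ((u - v) * S (Suc n) (u / sigma n ^ 2) (v / sigma n ^ 2)) / G (Suc n) - (u - v) * h u v"
      by (simp add: algebra_simps)
    also have "\<dots> = - (dphi_scaled n u * phi_mean_scaled n v - phi_mean_scaled n u * dphi_scaled n v) + ((u * bes1 u) * bes v - bes u * (v * bes1 v))"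
      unfolding S_wronskian h_lommel using G_pos[of n] by (simp add: field_simps)
    \<comment> \<open>Bilinear splitting: each Wronskian now has one factor of size
      \<open>W R / sigma n ^ 2\<close>. The constants \<open>2 * 1 * 2\<close> and
      \<open>2 * 1 * 1\<close> make the 6.\<close>
    also have "\<dots> = - (((dphi_scaled n u - u * bes1 u) * phi_mean_scaled n v - phi_mean_scaled n u * (dphi_scaled n v - v * bes1 v))
        + ((u * bes1 u) * (phi_mean_scaled n v - bes v) - (phi_mean_scaled n u - bes u) * (v * bes1 v)))"
      by algebra
    also have "\<bar>\<dots>\<bar> \<le> 2 * (W R / sigma n ^ 2) * (2 * W R) * \<bar>u - v\<bar> + 2 * W R * (W R / sigma n ^ 2) * \<bar>u - v\<bar>"
      unfolding abs_minus
      by (rule order_trans[OF abs_triangle_ineq add_mono[OF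
          lip_bounded_wronskian[OF lip_bounded_dphi_scaled[OF R] gn2 u] lip_bounded_wronskian[OF lip_bounded_u_bes1[OF R] lip_bounded_phi_mean_scaled[OF R] u]]])
    also have "\<dots> = (6 * (W R)\<^sup>2 / sigma n ^ 2) * \<bar>u - v\<bar>"
      by (simp add: power2_eq_square algebra_simps)
    finally have "\<bar>?D u\<bar> * \<bar>u - v\<bar> \<le> (6 * (W R)\<^sup>2 / sigma n ^ 2) * \<bar>u - v\<bar>"
      by (simp add: abs_mult mult.commute)
    moreover have "\<bar>u - v\<bar> > 0" using that by simp
    ultimately show ?thesis by (rule mult_right_le_imp_le)
  qed
  show ?thesis
  proof (cases "u = v")
    case True
    show ?thesis unfolding True
    proof (rule diagonal_bound[where f = ?D and v = v and R = R])
      show "isCont ?D v"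
        by (intro continuous_diff continuous_divide continuous_const S_isCont h_isCont) (use G_pos[of n] in auto)
    qed (use off uv in auto)
  qed (use off uv in auto)
qed

lemma S_approx_powr:
  assumes R: "R \<ge> 1"
  shows "\<exists>C n0. \<forall>n\<ge>n0. \<forall>u\<in>{0..<R}. \<forall>v\<in>{0..<R}.
    \<bar>S (Suc n) (u / sigma n ^ 2) (v / sigma n ^ 2) / sigma n powr (2 * a + 2) - h u v\<bar> \<le> C / sigma n ^ 2"
proof -
  obtain K where K: "\<forall>\<^sub>F n in sequentially. norm (G (Suc n) / sigma n powr (2 * a + 2) - 1) \<le> K * norm (1 / sigma n ^ 2)"
    using G_asymp by (rule landau_o.bigE)
  let ?W = "W R"
  have "filterlim sigma at_top sequentially" unfolding sigma_def[abs_def] by real_asymp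
  then have "\<forall>\<^sub>F n in sequentially. sigma n \<ge> 1" by (simp add: filterlim_at_top)
  with K have "\<forall>\<^sub>F n in sequentially. \<forall>u\<in>{0..<R}. \<forall>v\<in>{0..<R}.
    \<bar>S (Suc n) (u / sigma n ^ 2) (v / sigma n ^ 2) / sigma n powr (2 * a + 2) - h u v\<bar> \<le>
      (\<bar>K\<bar> * (6 * ?W\<^sup>2 + 2 * ?W * ?W) + 6 * ?W\<^sup>2) / sigma n ^ 2"
  proof eventually_elim
    case (elim n)
    show ?case
    proof (intro ballI)
      fix u v assume uv: "u \<in> {0..<R}" "v \<in> {0..<R}"
      define q where "q = G (Suc n) / sigma n powr (2 * a + 2)"
      define T where "T = S (Suc n) (u / sigma n ^ 2) (v / sigma n ^ 2) / G (Suc n)"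
      have Th: "\<bar>T - h u v\<bar> \<le> 6 * ?W\<^sup>2 / sigma n ^ 2"
        unfolding T_def by (rule S_approx[OF R elim(2) uv])
      have "6 * ?W\<^sup>2 / sigma n ^ 2 \<le> 6 * ?W\<^sup>2"
        using elim(2) by (intro divide_square_le) auto
      then have T: "\<bar>T\<bar> \<le> 6 * ?W\<^sup>2 + 2 * ?W * ?W"
        using Th h_bound[OF R uv] by linarith
      have "K * norm (1 / sigma n ^ 2) \<le> \<bar>K\<bar> / sigma n ^ 2"
        by (simp add: divide_right_mono)
      then have q: "\<bar>q - 1\<bar> \<le> \<bar>K\<bar> / sigma n ^ 2"
        using elim(1) unfolding q_def[symmetric] by simp
      have "S (Suc n) (u / sigma n ^ 2) (v / sigma n ^ 2) / sigma n powr (2 * a + 2) - h u v = (q - 1) * T + (T - h u v)"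
        using G_pos[of n] by (simp add: q_def T_def field_simps)
      also have "\<bar>\<dots>\<bar> \<le> \<bar>q - 1\<bar> * \<bar>T\<bar> + \<bar>T - h u v\<bar>"
        by (rule order_trans[OF abs_triangle_ineq]) (simp add: abs_mult)
      also have "\<dots> \<le> \<bar>K\<bar> / sigma n ^ 2 * (6 * ?W\<^sup>2 + 2 * ?W * ?W) + 6 * ?W\<^sup>2 / sigma n ^ 2"
        by (intro add_mono mult_mono q T Th) auto
      also have "\<dots> = (\<bar>K\<bar> * (6 * ?W\<^sup>2 + 2 * ?W * ?W) + 6 * ?W\<^sup>2) / sigma n ^ 2"
        by (simp add: add_divide_distrib)
      finally show "\<bar>S (Suc n) (u / sigma n ^ 2) (v / sigma n ^ 2) / sigma n powr (2 * a + 2) - h u v\<bar> \<le>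
          (\<bar>K\<bar> * (6 * ?W\<^sup>2 + 2 * ?W * ?W) + 6 * ?W\<^sup>2) / sigma n ^ 2" .
    qed
  qed
  then show ?thesis unfolding eventually_sequentially by blast
qed

end

section \<open>The expansions\<close>

text \<open>For the factor \<open>((1 - x) * (1 - y)) powr (b / 2)\<close> of the weight. The
  interval avoids 0, as the exponent may be negative; 1/4 arises from two factors of at least
  1/2.\<close>

lemma powr_minus_one_bound:
  fixes p :: real
  shows "\<exists>K\<ge>0. \<forall>z\<in>{1/4..1}. \<bar>z powr p - 1\<bar> \<le> K * \<bar>z - 1\<bar>"
proof -
  have "bounded ((\<lambda>z. p * z powr (p - 1)) ` {1/4..1})"
    by (intro compact_imp_bounded compact_continuous_image continuous_intros) auto
  then obtain K where K: "\<And>z. z \<in> {1/4..1} \<Longrightarrow> \<bar>p * z powr (p - 1)\<bar> \<le> K"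
    by (force simp: bounded_iff)
  have "\<bar>z powr p - 1\<bar> \<le> K * \<bar>z - 1\<bar>" if z: "z \<in> {1/4..1}" for z
  proof -
    have "norm (z powr p - 1 powr p) \<le> K * norm (z - 1)"
    proof (rule field_differentiable_bound[of "{1/4..1}" "\<lambda>z. z powr p" "\<lambda>z. p * z powr (p - 1)"])
      show "((\<lambda>z. z powr p) has_real_derivative p * x powr (p - 1)) (at x within {1/4..1})"
        if "x \<in> {1/4..1}" for x
        using that by (intro has_field_derivative_at_within[OF has_real_derivative_powr]) auto
    qed (use z K in auto)
    then show ?thesis by simp
  qed
  moreover have "K \<ge> 0" using K[of 1] by (force intro: order_trans[OF abs_ge_zero])
  ultimately show ?thesis by blast
qed

text \<open>Differentiability of \<open>f'\<close> at 1 makes \<open>f' l - f' 1\<close> at most a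
  multiple of \<open>l - 1\<close> nearby; the mean value inequality for \<open>f\<close> minus its
  linear part supplies the second power.\<close>

lemma quadratic_remainder:
  fixes f :: "real \<Rightarrow> real"
  assumes f: "\<And>l. l > 0 \<Longrightarrow> (f has_real_derivative f' l) (at l)"
    and f': "(f' has_real_derivative D) (at 1)"
  shows "\<exists>C e. e > 0 \<and> (\<forall>l. \<bar>l - 1\<bar> < e \<longrightarrow> \<bar>f l - f 1 - (l - 1) * f' 1\<bar> \<le> C * (l - 1) ^ 2)"
proof -
  have "((\<lambda>k. (f' (1 + k) - f' 1) / k) \<longlongrightarrow> D) (at 0)"
    using f' by (simp add: DERIV_def)
  then have "\<forall>\<^sub>F k in at 0. dist ((f' (1 + k) - f' 1) / k) D < 1"
    by (rule tendstoD) simp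
  then obtain d where d: "d > 0" "\<And>k. k \<noteq> 0 \<Longrightarrow> \<bar>k\<bar> < d \<Longrightarrow> \<bar>(f' (1 + k) - f' 1) / k - D\<bar> < 1"
    by (auto simp: eventually_at dist_real_def)
  define C where "C = \<bar>D\<bar> + 1"
  have lip: "\<bar>f' l - f' 1\<bar> \<le> C * \<bar>l - 1\<bar>" if "\<bar>l - 1\<bar> < d" for l
  proof (cases "l = 1")
    case False
    then have "\<bar>(f' l - f' 1) / (l - 1) - D\<bar> < 1"
      using d(2)[of "l - 1"] that by simp
    then have "\<bar>(f' l - f' 1) / (l - 1)\<bar> \<le> C"
      unfolding C_def by linarith
    then show ?thesis using False by (simp add: abs_divide divide_le_eq)
  qed simp
  have "\<bar>f l - f 1 - (l - 1) * f' 1\<bar> \<le> C * (l - 1) ^ 2" if l: "\<bar>l - 1\<bar> < min d 1" for l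
  proof -
    let ?k = "\<lambda>x. f x - x * f' 1"
    have "norm (?k l - ?k 1) \<le> (C * \<bar>l - 1\<bar>) * norm (l - 1)"
    proof (rule field_differentiable_bound[of "cball 1 \<bar>l - 1\<bar>" ?k "\<lambda>x. f' x - f' 1"])
      fix x :: real assume "x \<in> cball 1 \<bar>l - 1\<bar>"
      then have x: "\<bar>x - 1\<bar> \<le> \<bar>l - 1\<bar>" by (simp add: dist_real_def abs_minus_commute)
      have x0: "x > 0" using x l by linarith
      have lin: "((\<lambda>x. x * f' 1) has_real_derivative f' 1) (at x)"
        by (auto intro!: derivative_eq_intros)
      show "(?k has_real_derivative f' x - f' 1) (at x within cball 1 \<bar>l - 1\<bar>)"
        by (rule has_field_derivative_at_within) (rule DERIV_diff[OF f[OF x0] lin])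
      have "\<bar>f' x - f' 1\<bar> \<le> C * \<bar>x - 1\<bar>" using x l by (intro lip) auto
      also have "\<dots> \<le> C * \<bar>l - 1\<bar>" using x by (intro mult_left_mono) (auto simp: C_def)
      finally show "norm (f' x - f' 1) \<le> C * \<bar>l - 1\<bar>" by simp
    qed (auto simp: dist_real_def abs_minus_commute)
    moreover have "C * \<bar>l - 1\<bar> * norm (l - 1) = C * (l - 1) ^ 2"
      unfolding real_norm_def mult.assoc abs_mult_self_eq power2_eq_square ..
    moreover have "?k l - ?k 1 = f l - f 1 - (l - 1) * f' 1" by algebra
    ultimately show ?thesis by (simp only: real_norm_def)
  qed
  then show ?thesis using d(1) by (intro exI[of _ C] exI[of _ "min d 1"]) auto
qed

lemma bigo_inverse_square_Suc:
  fixes F :: "nat \<Rightarrow> real"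
  assumes "\<forall>\<^sub>F n in sequentially. \<bar>F (Suc n)\<bar> \<le> M / real (Suc n) ^ 2"
  shows "F \<in> O(\<lambda>N. 1 / real N ^ 2)"
proof (rule bigoI[of _ M])
  have "\<forall>\<^sub>F n in sequentially. norm (F (Suc n)) \<le> M * norm (1 / real (Suc n) ^ 2)"
    using assms by eventually_elim simp
  then show "\<forall>\<^sub>F N in sequentially. norm (F N) \<le> M * norm (1 / real N ^ 2)"
    by (subst (asm) eventually_sequentially_Suc)
qed

context jacobi
begin

section \<open>Return to Bessel functions and the Jacobi weight\<close>

lemma Gamma_pos: "Gamma (a + 1) > 0"
  using a by (intro Gamma_real_pos) auto

lemma bessel_J_sqrt:
  assumes "x > 0"
  shows "bessel_J a (sqrt x) = (x / 4) powr (a / 2) / Gamma (a + 1) * bes (x / 4)"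
proof -
  have coef: "(-1) ^ m / (fact m * Gamma (real m + a + 1)) * (sqrt x / 2) powr (2 * real m + a) =
      (x / 4) powr (a / 2) / Gamma (a + 1) * (bcoeff m * (x / 4) ^ m)" for m
  proof -
    have "sqrt x / 2 = sqrt (x / 4)"
      by (simp add: real_sqrt_divide)
    also have "\<dots> = (x / 4) powr (1 / 2)"
      using assms by (simp add: powr_half_sqrt)
    finally have "(sqrt x / 2) powr (2 * real m + a) = (x / 4) powr (real m + a / 2)"
      by (simp add: powr_powr add_divide_distrib)
    also have "\<dots> = (x / 4) ^ m * (x / 4) powr (a / 2)"
      using assms by (simp add: powr_add powr_realpow)
    finally have p: "(sqrt x / 2) powr (2 * real m + a) = (x / 4) ^ m * (x / 4) powr (a / 2)" .
    have "a + 1 \<notin> \<int>\<^sub>\<le>\<^sub>0" using a by (auto dest: nonpos_Ints_nonpos)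
    then have "pochhammer (a + 1) m = Gamma (a + 1 + real m) / Gamma (a + 1)"
      by (rule pochhammer_Gamma)
    then have "Gamma (real m + a + 1) = pochhammer (a + 1) m * Gamma (a + 1)"
      using Gamma_pos by (simp add: field_simps add_ac)
    then show ?thesis
      unfolding p bcoeff_def by (simp add: mult_ac)
  qed
  show ?thesis
    unfolding bessel_J_def coef bes_def
    by (rule suminf_mult) (rule summable_bcoeff)
qed

text \<open>Shared by both kernels: its 4 is the 1/4 of \<open>hard_kernel\<close> and also the one
  in the scaling \<open>4 * sigma n ^ 2\<close>.\<close>

definition prefactor :: "real \<Rightarrow> real \<Rightarrow> real" where
  "prefactor u v = (u * v) powr (a / 2) / (4 * Gamma (a + 1) ^ 2)"

lemma bessel_J_product:
  assumes "x > 0" "y > 0"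
  shows "bessel_J a (sqrt x) * bessel_J a (sqrt y) = 4 * prefactor (x / 4) (y / 4) * (bes (x / 4) * bes (y / 4))"
  unfolding bessel_J_sqrt[OF assms(1)] bessel_J_sqrt[OF assms(2)] prefactor_def powr_mult[of "x / 4"]
  using Gamma_pos by (simp add: power2_eq_square)

lemma hard_kernel_eq:
  assumes x: "x > 0" and y: "y > 0"
  shows "hard_kernel a x y = prefactor (x / 4) (y / 4) * h (x / 4) (y / 4)"
proof -
  have "(LBINT t:{0<..<1}. bessel_J a (sqrt (x * t)) * bessel_J a (sqrt (y * t))) =
    (LBINT t:{0<..<1}. (4 * prefactor (x / 4) (y / 4)) * (t powr a * (bes (x / 4 * t) * bes (y / 4 * t))))"
  proof (rule set_lebesgue_integral_cong)
    show "\<forall>t. t \<in> {0<..<1} \<longrightarrow> bessel_J a (sqrt (x * t)) * bessel_J a (sqrt (y * t)) =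
       4 * prefactor (x / 4) (y / 4) * (t powr a * (bes (x / 4 * t) * bes (y / 4 * t)))"
    proof (intro allI impI)
      fix t :: real assume "t \<in> {0<..<1}"
      then have t: "t > 0" by simp
      have "(x * t / 4 * (y * t / 4)) powr (a / 2) = ((x / 4 * (y / 4)) * (t * t)) powr (a / 2)"
        by (simp add: mult_ac)
      also have "\<dots> = (x / 4 * (y / 4)) powr (a / 2) * (t powr (a / 2) * t powr (a / 2))"
        unfolding powr_mult[of "x / 4 * (y / 4)"] powr_mult[of t] ..
      also have "t powr (a / 2) * t powr (a / 2) = t powr a"
        by (simp flip: powr_add)
      finally have "prefactor (x * t / 4) (y * t / 4) = prefactor (x / 4) (y / 4) * t powr a"
        by (simp add: prefactor_def)
      then show "bessel_J a (sqrt (x * t)) * bessel_J a (sqrt (y * t)) =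
         4 * prefactor (x / 4) (y / 4) * (t powr a * (bes (x / 4 * t) * bes (y / 4 * t)))"
        using bessel_J_product[of "x * t" "y * t"] x y t by simp
    qed
  qed simp
  also have "\<dots> = (4 * prefactor (x / 4) (y / 4)) * h (x / 4) (y / 4)"
    unfolding h_def weighted_int_def by (rule set_integral_mult_right)
  finally show ?thesis by (simp add: hard_kernel_def)
qed

lemma sqrt_weight:
  assumes s: "s > 0" and u: "0 < u" "u < s ^ 2" and v: "0 < v" "v < s ^ 2"
  shows "sqrt (jacobi_weight a b (u / s ^ 2) * jacobi_weight a b (v / s ^ 2)) =
    (u * v) powr (a / 2) * ((1 - u / s ^ 2) * (1 - v / s ^ 2)) powr (b / 2) / s powr (2 * a)"
proof -
  let ?x = "u / s ^ 2" and ?y = "v / s ^ 2"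
  have xy: "0 < ?x" "?x < 1" "0 < ?y" "?y < 1" using assms by auto
  have w: "jacobi_weight a b ?x * jacobi_weight a b ?y = (?x * ?y) powr a * ((1 - ?x) * (1 - ?y)) powr b"
    using xy unfolding powr_mult[of ?x] powr_mult[of "1 - ?x"] by (simp add: jacobi_weight_def)
  have "sqrt (jacobi_weight a b ?x * jacobi_weight a b ?y) = ((?x * ?y) powr a * ((1 - ?x) * (1 - ?y)) powr b) powr (1 / 2)"
    unfolding w by (subst powr_half_sqrt) auto
  also have "\<dots> = (?x * ?y) powr (a / 2) * ((1 - ?x) * (1 - ?y)) powr (b / 2)"
    by (simp only: powr_mult[of "(?x * ?y) powr a"] powr_powr) simp
  also have "?x * ?y = (u * v) / s powr 4"
    using s by (simp add: powr_numeral flip: power_add)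
  also have "\<dots> powr (a / 2) = (u * v) powr (a / 2) / s powr (2 * a)"
    by (simp only: powr_divide powr_powr) simp
  finally show ?thesis by simp
qed

text \<open>The error stays proportional to \<open>prefactor u v\<close>, which for negative
  \<open>a\<close> is unbounded near 0; in this form the bound is uniform down to 0.\<close>

lemma jacobi_kernel_approx:
  assumes R: "R \<ge> 1"
  shows "\<exists>C. \<forall>\<^sub>F n in sequentially. \<forall>u\<in>{0<..<R}. \<forall>v\<in>{0<..<R}.
    \<bar>jacobi_kernel a b (Suc n) (u / sigma n ^ 2) (v / sigma n ^ 2) / (4 * sigma n ^ 2) - prefactor u v * h u v\<bar>
      \<le> C * prefactor u v / sigma n ^ 2"
proof -
  obtain C n0 where C: "\<And>n u v. n \<ge> n0 \<Longrightarrow> u \<in> {0..<R} \<Longrightarrow> v \<in> {0..<R} \<Longrightarrow>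
    \<bar>S (Suc n) (u / sigma n ^ 2) (v / sigma n ^ 2) / sigma n powr (2 * a + 2) - h u v\<bar> \<le> C / sigma n ^ 2"
    using S_approx_powr[OF R] by blast
  obtain K where K: "K \<ge> 0" "\<And>z. z \<in> {1/4..1} \<Longrightarrow> \<bar>z powr (b / 2) - 1\<bar> \<le> K * \<bar>z - 1\<bar>"
    using powr_minus_one_bound by blast
  define H where "H = \<bar>C\<bar> + 2 * W R * W R"
  have "filterlim sigma at_top sequentially" unfolding sigma_def[abs_def] by real_asymp
  \<comment> \<open>Ensures \<open>sigma n ^ 2 >= 2 * R\<close>, so that both scaled arguments are
    at most 1/2 and \<open>z\<close> is at least 1/4.\<close>
  then have "\<forall>\<^sub>F n in sequentially. sigma n \<ge> 2 * R" by (simp add: filterlim_at_top)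
  then have "\<forall>\<^sub>F n in sequentially. \<forall>u\<in>{0<..<R}. \<forall>v\<in>{0<..<R}.
    \<bar>jacobi_kernel a b (Suc n) (u / sigma n ^ 2) (v / sigma n ^ 2) / (4 * sigma n ^ 2) - prefactor u v * h u v\<bar>
      \<le> (K * (2 * R) * H + \<bar>C\<bar>) * prefactor u v / sigma n ^ 2"
    using eventually_ge_at_top[of n0]
  proof eventually_elim
    case (elim n)
    let ?s = "sigma n"
    have s1: "?s \<ge> 1" using elim R by linarith
    have s2: "?s ^ 2 \<ge> 2 * R"
    proof -
      have "?s * 1 \<le> ?s * ?s" using s1 by (intro mult_left_mono) auto
      then show ?thesis using elim(1) unfolding power2_eq_square by linarith
    qed
    show ?case
    proof (intro ballI)
      fix u v assume uv: "u \<in> {0<..<R}" "v \<in> {0<..<R}"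
      let ?x = "u / ?s ^ 2" and ?y = "v / ?s ^ 2"
      define z where "z = (1 - ?x) * (1 - ?y)"
      define T where "T = S (Suc n) ?x ?y / ?s powr (2 * a + 2)"
      have xy: "0 < ?x" "?x \<le> 1 / 2" "0 < ?y" "?y \<le> 1 / 2"
        using uv s2 s1 by (auto simp: divide_le_eq)
      have "(1 / 2) * (1 / 2) \<le> z" "z \<le> 1 * 1"
        unfolding z_def by (rule mult_mono; use xy in linarith)+
      then have z: "z \<in> {1/4..1}" by simp
      have "\<bar>z - 1\<bar> \<le> ?x + ?y"
        using z mult_pos_pos[OF xy(1,3)] by (simp add: z_def algebra_simps)
      also have "\<dots> \<le> 2 * R / ?s ^ 2"
        using uv by (simp add: divide_right_mono flip: add_divide_distrib)
      finally have "\<bar>z powr (b / 2) - 1\<bar> \<le> K * (2 * R / ?s ^ 2)"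
        using K(2)[OF z] K(1) by (meson mult_left_mono order_trans)
      then have zb: "\<bar>z powr (b / 2) - 1\<bar> \<le> K * (2 * R) / ?s ^ 2" by simp
      have Th: "\<bar>T - h u v\<bar> \<le> \<bar>C\<bar> / ?s ^ 2"
      proof -
        have "\<bar>T - h u v\<bar> \<le> C / ?s ^ 2" unfolding T_def using elim(2) uv by (intro C) auto
        also have "\<dots> \<le> \<bar>C\<bar> / ?s ^ 2" by (intro divide_right_mono) auto
        finally show ?thesis .
      qed
      have "\<bar>C\<bar> / ?s ^ 2 \<le> \<bar>C\<bar>" using s1 by (intro divide_square_le) auto
      then have TH: "\<bar>T\<bar> \<le> H"
        using Th h_bound[OF R, of u v] uv unfolding H_def by auto
      have prefactor: "prefactor u v > 0" using uv Gamma_pos by (simp add: prefactor_def)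
      have sp: "?s powr (2 * a) * ?s ^ 2 = ?s powr (2 * a + 2)"
        using s1 by (simp add: powr_add powr_numeral)
      have "jacobi_kernel a b (Suc n) ?x ?y / (4 * ?s ^ 2) = prefactor u v * (z powr (b / 2) * (S (Suc n) ?x ?y / (?s powr (2 * a) * ?s ^ 2)))"
        unfolding jacobi_kernel_eq
        by (subst sqrt_weight) (use uv s1 s2 in \<open>auto simp: prefactor_def z_def mult_ac\<close>)
      also have "\<dots> = prefactor u v * (z powr (b / 2) * T)" unfolding sp T_def ..
      finally have "jacobi_kernel a b (Suc n) ?x ?y / (4 * ?s ^ 2) - prefactor u v * h u v =
          prefactor u v * ((z powr (b / 2) - 1) * T + (T - h u v))"
        by (simp add: algebra_simps)
      then have "\<bar>jacobi_kernel a b (Suc n) ?x ?y / (4 * ?s ^ 2) - prefactor u v * h u v\<bar> =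
          prefactor u v * \<bar>(z powr (b / 2) - 1) * T + (T - h u v)\<bar>"
        using prefactor by (simp add: abs_mult)
      also have "\<dots> \<le> prefactor u v * (K * (2 * R) / ?s ^ 2 * H + \<bar>C\<bar> / ?s ^ 2)"
      proof (intro mult_left_mono order_trans[OF abs_triangle_ineq] add_mono Th)
        show "\<bar>(z powr (b / 2) - 1) * T\<bar> \<le> K * (2 * R) / ?s ^ 2 * H"
          unfolding abs_mult using zb TH by (intro mult_mono) auto
      qed (use prefactor in simp)
      also have "\<dots> = (K * (2 * R) * H + \<bar>C\<bar>) * prefactor u v / ?s ^ 2"
        by (simp add: add_divide_distrib ring_distribs mult_ac)
      finally show "\<bar>jacobi_kernel a b (Suc n) ?x ?y / (4 * ?s ^ 2) - prefactor u v * h u v\<bar>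
        \<le> (K * (2 * R) * H + \<bar>C\<bar>) * prefactor u v / ?s ^ 2" .
    qed
  qed
  then show ?thesis by blast
qed

lemma sigma_eq: "sigma n = real (Suc n) + (a + b) / 2"
  by (simp add: sigma_def c_def field_simps)

text \<open>At \<open>n = 0\<close> the value \<open>1 + (a + b) / 2\<close> may be arbitrarily
  close to 0; from \<open>n = 1\<close> on, \<open>sigma n\<close> is at least half of
  \<open>real (Suc n)\<close>.\<close>

lemma inverse_sigma_bound: "n \<ge> 1 \<Longrightarrow> 1 / sigma n ^ 2 \<le> 4 / real (Suc n) ^ 2"
proof -
  assume "n \<ge> 1"
  then have "real n \<ge> 1" by simp
  then have "0 \<le> (a + 1) / 2 + (b + 1) / 2 + (real n - 1) / 2"
    using a b by (intro add_nonneg_nonneg) auto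
  also have "\<dots> = sigma n - real (Suc n) / 2" by (simp add: sigma_eq field_simps)
  finally have "real (Suc n) / 2 \<le> sigma n" by simp
  then have "(real (Suc n) / 2) ^ 2 \<le> sigma n ^ 2" by (intro power_mono) auto
  then have "1 / sigma n ^ 2 \<le> 1 / (real (Suc n) / 2) ^ 2"
    using sigma_pos[of n] by (intro divide_left_mono mult_pos_pos) auto
  then show ?thesis by (simp add: power_divide)
qed

theorem jacobi_kernel_shifted_expansion:
  assumes "X > 0" "Y > 0"
  shows "(\<lambda>N::nat. let N' = real N + (a + b) / 2 in
          1 / (4 * N' ^ 2) * jacobi_kernel a b N (X / (4 * N' ^ 2)) (Y / (4 * N' ^ 2))
        - hard_kernel a X Y) \<in> O(\<lambda>N. 1 / real N ^ 2)"
proof -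
  define R where "R = X + Y + 1"
  have R: "R \<ge> 1" using assms by (simp add: R_def)
  obtain C where C: "\<forall>\<^sub>F n in sequentially. \<forall>u\<in>{0<..<R}. \<forall>v\<in>{0<..<R}.
    \<bar>jacobi_kernel a b (Suc n) (u / sigma n ^ 2) (v / sigma n ^ 2) / (4 * sigma n ^ 2) - prefactor u v * h u v\<bar>
      \<le> C * prefactor u v / sigma n ^ 2"
    using jacobi_kernel_approx[OF R] by blast
  let ?D = "\<bar>C * prefactor (X / 4) (Y / 4)\<bar>"
  show ?thesis
  proof (rule bigo_inverse_square_Suc[where M = "?D * 4"])
    show "\<forall>\<^sub>F n in sequentially. \<bar>let N' = real (Suc n) + (a + b) / 2 in
        1 / (4 * N' ^ 2) * jacobi_kernel a b (Suc n) (X / (4 * N' ^ 2)) (Y / (4 * N' ^ 2))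
        - hard_kernel a X Y\<bar> \<le> ?D * 4 / real (Suc n) ^ 2"
      using C eventually_ge_at_top[of 1]
    proof eventually_elim
      case (elim n)
      have uv: "X / 4 \<in> {0<..<R}" "Y / 4 \<in> {0<..<R}" using assms by (auto simp: R_def)
      have "\<bar>jacobi_kernel a b (Suc n) (X / 4 / sigma n ^ 2) (Y / 4 / sigma n ^ 2) / (4 * sigma n ^ 2)
          - hard_kernel a X Y\<bar> \<le> C * prefactor (X / 4) (Y / 4) / sigma n ^ 2"
        unfolding hard_kernel_eq[OF assms] using elim(1) uv by blast
      also have "\<dots> \<le> ?D * (1 / sigma n ^ 2)"
        by (simp add: divide_right_mono)
      also have "\<dots> \<le> ?D * (4 / real (Suc n) ^ 2)"
        by (intro mult_left_mono inverse_sigma_bound elim) auto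
      finally show ?case
        unfolding Let_def sigma_eq[symmetric] by simp
    qed
  qed
qed

text \<open>With \<open>sigma n ^ 2 = lam n * N ^ 2\<close>, the unshifted arguments are the shifted
  ones at \<open>lam n * u\<close>, \<open>lam n * v\<close>. Multiplied by \<open>lam n\<close>,
  the leading term becomes \<open>K * f (lam n)\<close>; the \<open>1 / N\<close> correction is the
  derivative of \<open>f\<close> at 1 times the leading part \<open>q / N\<close> of
  \<open>lam n - 1\<close>.\<close>

theorem jacobi_kernel_expansion:
  assumes X: "X > 0" and Y: "Y > 0"
  shows "(\<lambda>N::nat. 1 / (4 * real N ^ 2) *
          jacobi_kernel a b N (X / (4 * real N ^ 2)) (Y / (4 * real N ^ 2))
        - (hard_kernel a X Y
           + (a + b) / (4 * real N) * bessel_J a (sqrt X) * bessel_J a (sqrt Y)))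
       \<in> O(\<lambda>N. 1 / real N ^ 2)"
proof -
  define R where "R = X + Y + 1"
  have R: "R \<ge> 1" using assms by (simp add: R_def)
  define u where "u = X / 4"
  define v where "v = Y / 4"
  have uv: "u > 0" "v > 0" using assms by (auto simp: u_def v_def)
  obtain C where C: "\<forall>\<^sub>F n in sequentially. \<forall>u\<in>{0<..<R}. \<forall>v\<in>{0<..<R}.
    \<bar>jacobi_kernel a b (Suc n) (u / sigma n ^ 2) (v / sigma n ^ 2) / (4 * sigma n ^ 2) - prefactor u v * h u v\<bar>
      \<le> C * prefactor u v / sigma n ^ 2"
    using jacobi_kernel_approx[OF R] by blast
  define f where "f l = l powr (a + 1) * h (l * u) (l * v)" for l
  define f' where "f' l = l powr a * (bes (l * u) * bes (l * v))" for l
  define B where "B = bes u * bes v"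
  have "(f has_real_derivative f' l) (at l)" if "l > 0" for l
    unfolding f_def f'_def using that by (rule h_scale_deriv)
  moreover have "(f' has_real_derivative a * (bes u * bes v) + (bes1 u * u * bes v + bes1 v * v * bes u)) (at 1)"
    unfolding f'_def by (auto intro!: derivative_eq_intros)
  ultimately obtain C1 d where d: "d > 0"
    and C1: "\<And>l. \<bar>l - 1\<bar> < d \<Longrightarrow> \<bar>f l - f 1 - (l - 1) * f' 1\<bar> \<le> C1 * (l - 1) ^ 2"
    using quadratic_remainder by blast
  define lam where "lam n = (sigma n / real (Suc n)) ^ 2" for n
  define q where "q = a + b"
  have lam: "lam n - 1 = q / real (Suc n) + q ^ 2 / 4 / real (Suc n) ^ 2" for n
  proof -
    have "((N + q / 2) / N) ^ 2 - 1 = q / N + q ^ 2 / 4 / N ^ 2" if "N > 0" for N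
      using that by (simp add: field_simps power2_eq_square)
    then show ?thesis by (simp only: lam_def sigma_eq q_def of_nat_0_less_iff zero_less_Suc)
  qed
  define Q where "Q = \<bar>q\<bar> + q ^ 2 / 4"
  have lam1: "\<bar>lam n - 1\<bar> \<le> Q / real (Suc n)" for n
  proof -
    have "q ^ 2 / 4 / real (Suc n) ^ 2 \<le> q ^ 2 / 4 / real (Suc n)"
      using self_le_power[of "real (Suc n)" 2] by (intro divide_left_mono) auto
    then have "\<bar>lam n - 1\<bar> \<le> \<bar>q / real (Suc n)\<bar> + q ^ 2 / 4 / real (Suc n)"
      unfolding lam by (intro order_trans[OF abs_triangle_ineq] add_mono) auto
    then show ?thesis by (simp add: Q_def add_divide_distrib)
  qed
  have "(\<lambda>n. Q / real (Suc n)) \<longlonglongrightarrow> 0" by real_asymp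
  then have "\<forall>\<^sub>F n in sequentially. dist (Q / real (Suc n)) 0 < min d 1"
    using d by (intro tendstoD) auto
  then have ev: "\<forall>\<^sub>F n in sequentially. \<bar>lam n - 1\<bar> < min d 1"
  proof eventually_elim
    case (elim n)
    have "\<bar>lam n - 1\<bar> \<le> \<bar>Q / real (Suc n) - 0\<bar>" using lam1[of n] by linarith
    also have "\<dots> < min d 1" using elim unfolding dist_real_def .
    finally show ?case .
  qed
  define K where "K = prefactor u v"
  have K: "K > 0" using uv Gamma_pos by (simp add: K_def prefactor_def)
  \<comment> \<open>One summand each for the approximation at the moving points (with
    \<open>lam n < 2\<close> and \<open>1 / sigma n ^ 2 <= 4 / N ^ 2\<close>), the quadratic
    remainder of \<open>f\<close>, and the second-order part of \<open>lam n - 1\<close>.\<close>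
  define M where "M = \<bar>C\<bar> * K * 2 powr (a + 1) * 4 + K * (\<bar>C1\<bar> * Q ^ 2) + K * (\<bar>B\<bar> * (q ^ 2 / 4))"
  show ?thesis
  proof (rule bigo_inverse_square_Suc[where M = M])
    show "\<forall>\<^sub>F n in sequentially. \<bar>1 / (4 * real (Suc n) ^ 2) *
          jacobi_kernel a b (Suc n) (X / (4 * real (Suc n) ^ 2)) (Y / (4 * real (Suc n) ^ 2))
        - (hard_kernel a X Y
           + (a + b) / (4 * real (Suc n)) * bessel_J a (sqrt X) * bessel_J a (sqrt Y))\<bar> \<le> M / real (Suc n) ^ 2"
      using C ev eventually_ge_at_top[of 1]
    proof eventually_elim
      case (elim n)
      let ?N = "real (Suc n)"
      let ?l = "lam n"
      let ?J = "jacobi_kernel a b (Suc n) (X / (4 * ?N ^ 2)) (Y / (4 * ?N ^ 2))"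
      have l: "?l > 0" "?l < 2" "\<bar>?l - 1\<bar> < d" using elim(2) by auto
      have luv: "?l * u \<in> {0<..<R}" "?l * v \<in> {0<..<R}"
      proof -
        have "?l * X < 2 * X" "?l * Y < 2 * Y" using l assms by simp_all
        moreover have "?l * u = ?l * X / 4" "?l * v = ?l * Y / 4" by (simp_all add: u_def v_def)
        moreover have "0 < ?l * u" "0 < ?l * v" using l uv by simp_all
        ultimately show "?l * u \<in> {0<..<R}" "?l * v \<in> {0<..<R}"
          using assms unfolding R_def greaterThanLessThan_iff by linarith+
      qed
      have s: "sigma n ^ 2 = ?l * ?N ^ 2" by (simp add: lam_def power_divide)
      have arg: "?l * u / sigma n ^ 2 = X / (4 * ?N ^ 2)" "?l * v / sigma n ^ 2 = Y / (4 * ?N ^ 2)"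
        unfolding s u_def v_def using l(1) by (simp_all add: field_simps)
      have kapl: "?l * prefactor (?l * u) (?l * v) = ?l powr (a + 1) * K"
      proof -
        have "(?l * u * (?l * v)) powr (a / 2) = (?l * ?l * (u * v)) powr (a / 2)" by (simp add: mult_ac)
        also have "\<dots> = ?l powr (a / 2) * ?l powr (a / 2) * (u * v) powr (a / 2)"
          using l uv by (simp add: powr_mult)
        also have "?l powr (a / 2) * ?l powr (a / 2) = ?l powr a" by (simp flip: powr_add)
        finally show ?thesis using l(1) by (simp add: prefactor_def K_def powr_add)
      qed
      have "\<bar>?J / (4 * sigma n ^ 2) - prefactor (?l * u) (?l * v) * h (?l * u) (?l * v)\<bar>
          \<le> C * prefactor (?l * u) (?l * v) / sigma n ^ 2"
        using elim(1) luv arg by metis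
      then have "?l * \<bar>?J / (4 * sigma n ^ 2) - prefactor (?l * u) (?l * v) * h (?l * u) (?l * v)\<bar>
          \<le> ?l * (C * prefactor (?l * u) (?l * v) / sigma n ^ 2)"
        using l(1) by (intro mult_left_mono) auto
      also have "?l * (C * prefactor (?l * u) (?l * v) / sigma n ^ 2) = C * (?l * prefactor (?l * u) (?l * v)) / sigma n ^ 2"
        by simp
      also have "\<dots> = C * K * ?l powr (a + 1) * (1 / sigma n ^ 2)"
        unfolding kapl by simp
      also have "\<dots> \<le> (\<bar>C\<bar> * K * 2 powr (a + 1)) * (4 / ?N ^ 2)"
      proof (rule mult_mono)
        show "C * K * ?l powr (a + 1) \<le> \<bar>C\<bar> * K * 2 powr (a + 1)"
          using K l a by (intro mult_mono mult_right_mono powr_mono2) auto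
      qed (use K inverse_sigma_bound[OF elim(3)] in auto)
      also have "?l * \<bar>?J / (4 * sigma n ^ 2) - prefactor (?l * u) (?l * v) * h (?l * u) (?l * v)\<bar> =
          \<bar>?l * (?J / (4 * sigma n ^ 2)) - (?l * prefactor (?l * u) (?l * v)) * h (?l * u) (?l * v)\<bar>"
        using l(1) by (simp add: abs_mult_pos' right_diff_distrib mult.assoc)
      also have "?l * (?J / (4 * sigma n ^ 2)) = 1 / (4 * ?N ^ 2) * ?J"
        unfolding s using l(1) by simp
      also have "(?l * prefactor (?l * u) (?l * v)) * h (?l * u) (?l * v) = K * f ?l"
        unfolding kapl f_def by simp
      finally have E1: "\<bar>1 / (4 * ?N ^ 2) * ?J - K * f ?l\<bar> \<le> \<bar>C\<bar> * K * 2 powr (a + 1) * 4 / ?N ^ 2"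
        by simp
      have f1: "f 1 = h u v" "f' 1 = B" by (simp_all add: f_def f'_def B_def)
      have "\<bar>f ?l - h u v - (?l - 1) * B\<bar> \<le> C1 * (?l - 1) ^ 2"
        using C1[OF l(3)] unfolding f1 .
      also have "\<dots> \<le> \<bar>C1\<bar> * (Q / ?N) ^ 2"
      proof (rule mult_mono)
        show "(?l - 1) ^ 2 \<le> (Q / ?N) ^ 2"
          using power_mono[OF lam1[of n], of 2] by simp
      qed auto
      finally have "K * \<bar>f ?l - h u v - (?l - 1) * B\<bar> \<le> K * (\<bar>C1\<bar> * (Q / ?N) ^ 2)"
        using K by (intro mult_left_mono) auto
      then have E2: "\<bar>K * (f ?l - h u v - (?l - 1) * B)\<bar> \<le> K * (\<bar>C1\<bar> * Q ^ 2) / ?N ^ 2"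
        using K by (simp add: abs_mult power_divide)
      have "K * (((?l - 1) - q / ?N) * B) = K * (B * (q ^ 2 / 4)) / ?N ^ 2"
        unfolding lam by simp
      then have E3: "\<bar>K * (((?l - 1) - q / ?N) * B)\<bar> \<le> K * (\<bar>B\<bar> * (q ^ 2 / 4)) / ?N ^ 2"
        using K by (simp add: abs_mult)
      have JJ: "(a + b) / (4 * ?N) * bessel_J a (sqrt X) * bessel_J a (sqrt Y) = q / ?N * (K * B)"
      proof -
        have "q / (4 * N) * (4 * k * z) = q / N * (k * z)" for N k z :: real
          by simp
        then show ?thesis
          unfolding mult.assoc[of _ "bessel_J a (sqrt X)"] bessel_J_product[OF X Y]
            q_def[symmetric] u_def[symmetric] v_def[symmetric] K_def[symmetric] B_def[symmetric] .
      qed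
      have HK: "hard_kernel a X Y = K * h u v"
        using hard_kernel_eq[OF X Y] by (simp add: K_def u_def v_def)
      have eq: "1 / (4 * ?N ^ 2) * ?J - (hard_kernel a X Y
           + (a + b) / (4 * ?N) * bessel_J a (sqrt X) * bessel_J a (sqrt Y)) =
        (1 / (4 * ?N ^ 2) * ?J - K * f ?l) + K * (f ?l - h u v - (?l - 1) * B)
          + K * (((?l - 1) - q / ?N) * B)"
        unfolding JJ HK by algebra
      have M: "M / ?N ^ 2 = \<bar>C\<bar> * K * 2 powr (a + 1) * 4 / ?N ^ 2
          + K * (\<bar>C1\<bar> * Q ^ 2) / ?N ^ 2 + K * (\<bar>B\<bar> * (q ^ 2 / 4)) / ?N ^ 2"
        by (simp only: M_def add_divide_distrib)
      have triangle: "\<bar>x\<bar> \<le> B1 + B2 + B3"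
        if "x = x1 + x2 + x3" "\<bar>x1\<bar> \<le> B1" "\<bar>x2\<bar> \<le> B2" "\<bar>x3\<bar> \<le> B3" for x x1 x2 x3 B1 B2 B3 :: real
        using that by linarith
      show ?case
        unfolding M by (rule triangle[OF eq E1 E2 E3])
    qed
  qed
qed

section \<open>The Euler operator on the hard edge kernel\<close>

lemma hard_kernel_deriv:
  assumes X: "X > 0" and Y: "Y > 0"
  shows "X * deriv (\<lambda>x. hard_kernel a x Y) X =
     prefactor (X / 4) (Y / 4) * (a / 2 * h (X / 4) (Y / 4) + X / 4 * h1 (X / 4) (Y / 4))"
proof -
  let ?H = "\<lambda>x. prefactor (x / 4) (Y / 4) * h (x / 4) (Y / 4)"
  let ?D = "a / 2 * prefactor (X / 4) (Y / 4) / X * h (X / 4) (Y / 4) + h1 (X / 4) (Y / 4) * (1 / 4) * prefactor (X / 4) (Y / 4)"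
  have k: "((\<lambda>x. prefactor (x / 4) (Y / 4)) has_real_derivative a / 2 * prefactor (X / 4) (Y / 4) / X) (at X)"
  proof -
    have "((\<lambda>x. (x / 4 * (Y / 4)) powr (a / 2)) has_real_derivative
        (a / 2 * (X / 4 * (Y / 4)) powr (a / 2 - 1)) * (1 / 4 * (Y / 4))) (at X)"
      using X Y by (intro DERIV_chain2[OF has_real_derivative_powr]) (auto intro!: derivative_eq_intros)
    also have "(X / 4 * (Y / 4)) powr (a / 2 - 1) = (X / 4 * (Y / 4)) powr (a / 2) / (X / 4 * (Y / 4))"
      using X Y by (simp add: powr_diff)
    also have "a / 2 * ((X / 4 * (Y / 4)) powr (a / 2) / (X / 4 * (Y / 4))) * (1 / 4 * (Y / 4)) =
        a / 2 * (X / 4 * (Y / 4)) powr (a / 2) / X"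
      using X Y by (simp add: field_simps)
    finally show ?thesis
      unfolding prefactor_def by (rule DERIV_cong[OF DERIV_cdivide]) simp
  qed
  have hd: "((\<lambda>x. h (x / 4) (Y / 4)) has_real_derivative h1 (X / 4) (Y / 4) * (1 / 4)) (at X)"
    by (rule DERIV_chain2[OF h_deriv]) (auto intro!: derivative_eq_intros)
  have "(?H has_real_derivative ?D) (at X)"
    by (rule DERIV_cong[OF DERIV_mult[OF k hd]]) simp
  then have "((\<lambda>x. hard_kernel a x Y) has_real_derivative ?D) (at X)"
    \<comment> \<open>\<open>hard_kernel_eq\<close> holds for positive arguments, an open set around
      \<open>X\<close>.\<close>
    by (rule has_field_derivative_transform_within_open[of _ _ _ "{0<..}"])
      (use X Y in \<open>auto simp: hard_kernel_eq\<close>)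
  then have "deriv (\<lambda>x. hard_kernel a x Y) X = ?D" by (rule DERIV_imp_deriv)
  then show ?thesis using X by (simp add: field_simps)
qed

lemma hard_kernel_commute: "hard_kernel a x y = hard_kernel a y x"
  by (simp add: hard_kernel_def mult.commute)

text \<open>The power factor contributes \<open>a / 2\<close> from each variable; with the summand 1
  this makes the \<open>a + 1\<close> of \<open>h_euler\<close>.\<close>

lemma hard_kernel_euler:
  assumes X: "X > 0" and Y: "Y > 0"
  shows "X * deriv (\<lambda>x. hard_kernel a x Y) X + Y * deriv (\<lambda>y. hard_kernel a X y) Y + hard_kernel a X Y =
     1 / 4 * (bessel_J a (sqrt X) * bessel_J a (sqrt Y))"
proof -
  let ?u = "X / 4" and ?v = "Y / 4"
  have "(\<lambda>y. hard_kernel a X y) = (\<lambda>y. hard_kernel a y X)"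
    by (rule ext) (rule hard_kernel_commute)
  then have "Y * deriv (\<lambda>y. hard_kernel a X y) Y = Y * deriv (\<lambda>y. hard_kernel a y X) Y"
    by (rule arg_cong)
  also have "\<dots> = prefactor ?v ?u * (a / 2 * h ?v ?u + ?v * h1 ?v ?u)"
    by (rule hard_kernel_deriv[OF Y X])
  also have "prefactor ?v ?u = prefactor ?u ?v"
    by (simp add: prefactor_def mult.commute)
  also have "h ?v ?u = h ?u ?v"
    by (rule h_commute)
  finally have dY: "Y * deriv (\<lambda>y. hard_kernel a X y) Y = prefactor ?u ?v * (a / 2 * h ?u ?v + ?v * h1 ?v ?u)" .
  have "X * deriv (\<lambda>x. hard_kernel a x Y) X + Y * deriv (\<lambda>y. hard_kernel a X y) Y + hard_kernel a X Y =
     prefactor ?u ?v * (?u * h1 ?u ?v + ?v * h1 ?v ?u + (a + 1) * h ?u ?v)"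
    unfolding hard_kernel_deriv[OF X Y] dY hard_kernel_eq[OF X Y] by (simp add: algebra_simps)
  then show ?thesis
    unfolding h_euler bessel_J_product[OF X Y] by simp
qed

end

theorem mainTheorem2:
  fixes a b X Y :: real
  assumes "a > -1" and "b > -1" and "X > 0" and "Y > 0"
  shows
    "(\<lambda>N::nat. 1 / (4 * real N ^ 2) *
          jacobi_kernel a b N (X / (4 * real N ^ 2)) (Y / (4 * real N ^ 2))
        - (hard_kernel a X Y
           + (a + b) / (4 * real N) * bessel_J a (sqrt X) * bessel_J a (sqrt Y)))
       \<in> O(\<lambda>N. 1 / real N ^ 2)
     \<and> (\<lambda>N::nat. 1 / (4 * real N ^ 2) *
          jacobi_kernel a b N (X / (4 * real N ^ 2)) (Y / (4 * real N ^ 2))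
        - (hard_kernel a X Y
           + (a + b) / real N *
               (X * deriv (\<lambda>x. hard_kernel a x Y) X
                + Y * deriv (\<lambda>y. hard_kernel a X y) Y
                + hard_kernel a X Y)))
       \<in> O(\<lambda>N. 1 / real N ^ 2)
     \<and> (\<lambda>N::nat. let N' = real N + (a + b) / 2 in
          1 / (4 * N' ^ 2) *
          jacobi_kernel a b N (X / (4 * N' ^ 2)) (Y / (4 * N' ^ 2))
        - hard_kernel a X Y)
       \<in> O(\<lambda>N. 1 / real N ^ 2)"
proof -
  interpret jacobi a b
    using assms by unfold_locales
  note first = jacobi_kernel_expansion[OF assms(3,4)]
  \<comment> \<open>An exact identity for every \<open>N\<close>, also at \<open>N = 0\<close>,
    where division by zero makes both sides 0. The second expansion is therefore the first one
    rewritten.\<close>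
  have euler: "(a + b) / real N *
      (X * deriv (\<lambda>x. hard_kernel a x Y) X + Y * deriv (\<lambda>y. hard_kernel a X y) Y + hard_kernel a X Y) =
    (a + b) / (4 * real N) * bessel_J a (sqrt X) * bessel_J a (sqrt Y)" for N
    unfolding hard_kernel_euler[OF assms(3,4)] by simp
  show ?thesis
    unfolding euler by (intro conjI first jacobi_kernel_shifted_expansion assms)
qed

end
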